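(* Let $(X,d)$ be a separable metric space such that the action $(Iso(X),X)$ is Cauchy-indivisible. The following are equivalent: (i) The map $\omega: E\times (X\cup X_l)\to (X\cup X_l)\times\widehat X$, $\omega(f,y)=(y,fy)$, is proper. (ii) $E$ is a group (precisely, a closed subgroup of $Iso(\widehat X)$). (iii) $Iso(X)$ has a Weil completion with respect to the uniformity of pointwise convergence (in this case $E$ is the Weil completion of $Iso(X)$).
   Context: $Iso(X)$ is the group of surjective isometries of $(X,d)$ with the topology of pointwise convergence; it acts on $X$ by evaluation. For a net $\{z_i\}$ in a space $Z$, "$z_i\to\infty$ in $Z$" means that $\{z_i\}$ has no convergent subnet in $Z$. The action $(Iso(X),X)$ is Cauchy-indivisible if: whenever $\{g_i\}$ is a net in $Iso(X)$ with $g_i\to\infty$ in $Iso(X)$ and $\{g_ix\}$ is a Cauchy net for some $x\in X$, then $\{g_ix\}$ is a Cauchy net for every $x\in X$. $(\widehat X,\widehat d)$ is the completion of $(X,d)$; $\widehat g$ is the extension of $g\in Iso(X)$ to $\widehat X$, and $\widehat{Iso(X)}=\{\widehat g: g\in Iso(X)\}$. $C(\widehat X,\widehat X)$ is the space of continuous selfmaps of $\widehat X$ with the topology of pointwise convergence. $E$ (the Ellis semigroup) is the closure of $\widehat{Iso(X)}$ in $C(\widehat X,\widehat X)$, with the topology of pointwise convergence and composition of maps. Put $H=\{h\in C(\widehat X,\widehat X):$ there is a sequence $\{g_n\}\subset Iso(X)$ with $g_n\to\infty$ in $Iso(X)$ and $\widehat{g_n}\to h$ in $C(\widehat X,\widehat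 X)\}$ and $X_l=\{hx: h\in H,\ x\in X\}$. A continuous map is proper in the sense of Bourbaki (closed with compact fibers; for metrizable spaces equivalently, preimages of compact sets are compact). A topological group has a Weil completion (with respect to the uniformity of pointwise convergence, which on $Iso(X)$ coincides with the left uniformity) if it can be embedded densely, as a topological group, in a topological group that is complete with respect to its left uniform structure. In (iii), $Iso(X)$ is embedded in $E$ by $g\mapsto\widehat g$. *)

theory Defs
  imports "HOL-Analysis.Analysis" "HOL-Algebra.Group"
begin

no_notation eq_closure_of (\<open>closure'_of\<index>\<close>)

text \<open>
  The type \<open>'a\<close> plays the role of the metric space \<open>X\<close> and the type \<open>'b\<close> that of its completion.
  Sets of maps carry the topology of pointwise convergence, which is the topology of the type
  \<open>'a \<Rightarrow> 'b\<close> (\<open>open_fun_def\<close>: the product topology); subspaces are written \<open>top_of_set S\<close>.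
\<close>

definition isometries :: "('a::metric_space \<Rightarrow> 'a) set"
  where "isometries = {g. surj g \<and> (\<forall>x y. dist (g x) (g y) = dist x y)}"

definition map_monoid :: "('a \<Rightarrow> 'a) set \<Rightarrow> ('a \<Rightarrow> 'a) monoid"
  where "map_monoid S = \<lparr>carrier = S, monoid.mult = (\<circ>), one = id\<rparr>"


section \<open>Divergence and Cauchy indivisibility\<close>

text \<open>
  A net is rendered as a family \<open>z\<close> along a proper filter \<open>F\<close> on its index type (for a directed
  index set: the filter of tails), and its subnets as the family \<open>z\<close> along the proper filters finer
  than \<open>F\<close>.
\<close>

definition to_infinity :: "'z topology \<Rightarrow> ('i \<Rightarrow> 'z) \<Rightarrow> 'i filter \<Rightarrow> bool"
  where "to_infinity T z F \<longleftrightarrow> \<not> (\<exists>F' l. F' \<le> F \<and> F' \<noteq> bot \<and> limitin T z l F')"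

lemma to_infinity_filtermap: "to_infinity T id (filtermap z F) \<longleftrightarrow> to_infinity T z F"
proof -
  have "\<exists>F' l. F' \<le> F \<and> F' \<noteq> bot \<and> limitin T z l F'"
    if G: "G \<le> filtermap z F" "G \<noteq> bot" "limitin T id l G" for G l
  proof -
    let ?F' = "inf F (filtercomap z G)"
    have "?F' \<noteq> bot"
    proof
      assume "?F' = bot"
      then have "eventually (\<lambda>_. False) ?F'" by simp
      then obtain P Q where PQ: "eventually P F" "eventually Q G" "\<And>x. P x \<Longrightarrow> Q (z x) \<Longrightarrow> False"
        unfolding eventually_inf eventually_filtercomap by metis
      have "eventually (\<lambda>y. \<exists>x. P x \<and> y = z x) (filtermap z F)"
        unfolding eventually_filtermap using PQ(1) by (auto elim: eventually_mono)
      then have "eventually (\<lambda>y. \<exists>x. P x \<and> y = z x) G"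
        using G(1) by (simp add: le_filter_def)
      with PQ(2) have "eventually (\<lambda>_. False) G"
        by eventually_elim (use PQ(3) in blast)
      then show False using G(2) by (simp add: eventually_False)
    qed
    moreover have "limitin T z l ?F'"
      unfolding limitin_def
    proof (intro conjI allI impI)
      show "l \<in> topspace T" using G(3) by (simp add: limitin_def)
    next
      fix U assume "openin T U \<and> l \<in> U"
      then have "eventually (\<lambda>y. y \<in> U) G" using G(3) by (auto simp: limitin_def)
      then have "eventually (\<lambda>x. z x \<in> U) (filtercomap z G)" by (rule eventually_filtercomapI)
      then show "eventually (\<lambda>x. z x \<in> U) ?F'" by (meson filter_leD inf_le2)
    qed
    ultimately show ?thesis by (meson inf_le1)
  qed
  moreover have "\<exists>G l. G \<le> filtermap z F \<and> G \<noteq> bot \<and> limitin T id l G"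
    if "F' \<le> F" "F' \<noteq> bot" "limitin T z l F'" for F' l
  proof (intro exI conjI)
    show "filtermap z F' \<le> filtermap z F" using that(1) by (rule filtermap_mono)
    show "filtermap z F' \<noteq> bot" using that(2) by (simp add: filtermap_bot_iff)
    show "limitin T id l (filtermap z F')"
      using that(3) by (simp add: limitin_def eventually_filtermap)
  qed
  ultimately show ?thesis unfolding to_infinity_def by blast
qed

text \<open>
  It suffices to speak of filters on the set \<open>G\<close> of maps itself;
  \<open>cauchy_indivisible_family\<close> gives the property for nets over an arbitrary index type.
\<close>

definition cauchy_indivisible :: "('a::metric_space \<Rightarrow> 'a) set \<Rightarrow> bool"
  where "cauchy_indivisible G \<longleftrightarrow>
    (\<forall>F. F \<noteq> bot \<and> eventually (\<lambda>g. g \<in> G) F \<and> to_infinity (top_of_set G) id F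
         \<and> (\<exists>x. cauchy_filter (filtermap (\<lambda>g. g x) F))
       \<longrightarrow> (\<forall>x. cauchy_filter (filtermap (\<lambda>g. g x) F)))"

lemma cauchy_indivisible_family:
  assumes "cauchy_indivisible G" "F \<noteq> bot" "eventually (\<lambda>i. g i \<in> G) F"
    and "to_infinity (top_of_set G) g F" "cauchy_filter (filtermap (\<lambda>i. g i x) F)"
  shows "cauchy_filter (filtermap (\<lambda>i. g i y) F)"
  using assms(1)[unfolded cauchy_indivisible_def, rule_format, of "filtermap g F" y] assms(2-)
  by (auto simp: filtermap_bot_iff eventually_filtermap to_infinity_filtermap filtermap_filtermap)


section \<open>The completion, the Ellis semigroup and the limit points\<close>

definition completion_embedding :: "('a::metric_space \<Rightarrow> 'b::complete_space) \<Rightarrow> bool"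
  where "completion_embedding \<iota> \<longleftrightarrow>
    (\<forall>x y. dist (\<iota> x) (\<iota> y) = dist x y) \<and> closure (range \<iota>) = UNIV"

definition hat :: "('a::metric_space \<Rightarrow> 'b::complete_space) \<Rightarrow> ('a \<Rightarrow> 'a) \<Rightarrow> 'b \<Rightarrow> 'b"
  where "hat \<iota> g = (THE f. continuous_on UNIV f \<and> (\<forall>x. f (\<iota> x) = \<iota> (g x)))"

lemma hat_unique_existence:
  fixes \<iota> :: "'a::metric_space \<Rightarrow> 'b::complete_space"
  assumes \<iota>: "completion_embedding \<iota>" and g: "g \<in> isometries"
  shows "\<exists>!f. continuous_on UNIV f \<and> (\<forall>x. f (\<iota> x) = \<iota> (g x))"
proof -
  have dist: "dist (\<iota> x) (\<iota> y) = dist x y" for x y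
    using \<iota> by (simp add: completion_embedding_def)
  have dense: "closure (range \<iota>) = UNIV"
    using \<iota> by (simp add: completion_embedding_def)
  have "inj \<iota>" by (rule injI) (metis dist dist_eq_0_iff)
  define k where "k = \<iota> \<circ> g \<circ> inv_into UNIV \<iota>"
  have k: "k (\<iota> x) = \<iota> (g x)" for x
    using \<open>inj \<iota>\<close> by (simp add: k_def)
  have "uniformly_continuous_on (range \<iota>) k"
    unfolding uniformly_continuous_on_def using g
    by (auto simp: k dist isometries_def)
  then obtain f where f: "uniformly_continuous_on (closure (range \<iota>)) f"
      "\<And>y. y \<in> range \<iota> \<Longrightarrow> k y = f y"
    by (rule uniformly_continuous_on_extension_on_closure) blast
  show ?thesis
  proof (rule ex1I)
    show "continuous_on UNIV f \<and> (\<forall>x. f (\<iota> x) = \<iota> (g x))"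
      using f dense uniformly_continuous_imp_continuous by (metis k rangeI)
  next
    fix f' assume f': "continuous_on UNIV f' \<and> (\<forall>x. f' (\<iota> x) = \<iota> (g x))"
    have "closed {y. f' y = f y}"
      using f' f(1) dense by (intro closed_Collect_eq) (auto intro: uniformly_continuous_imp_continuous)
    moreover have "range \<iota> \<subseteq> {y. f' y = f y}" using f' f(2) k by force
    ultimately show "f' = f" using closure_minimal dense by blast
  qed
qed

definition ellis :: "('a::metric_space \<Rightarrow> 'b::complete_space) \<Rightarrow> ('b \<Rightarrow> 'b) set"
  where "ellis \<iota> = top_of_set {f. continuous_on UNIV f} closure_of (hat \<iota> ` isometries)"

definition divergent_limits :: "('a::metric_space \<Rightarrow> 'b::complete_space) \<Rightarrow> ('b \<Rightarrow> 'b) set"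
  where "divergent_limits \<iota> = {h. continuous_on UNIV h \<and>
    (\<exists>g :: nat \<Rightarrow> 'a \<Rightarrow> 'a. range g \<subseteq> isometries
       \<and> to_infinity (top_of_set isometries) g sequentially
       \<and> limitin (top_of_set {f. continuous_on UNIV f}) (\<lambda>n. hat \<iota> (g n)) h sequentially)}"

definition limit_points :: "('a::metric_space \<Rightarrow> 'b::complete_space) \<Rightarrow> 'b set"
  where "limit_points \<iota> = {h (\<iota> x) |h x. h \<in> divergent_limits \<iota>}"

text \<open>The library notion \<open>proper_map\<close> (closed, compact fibres) does not include continuity.\<close>

definition continuous_proper_map :: "'a topology \<Rightarrow> 'b topology \<Rightarrow> ('a \<Rightarrow> 'b) \<Rightarrow> bool"
  where "continuous_proper_map X Y f \<longleftrightarrow> continuous_map X Y f \<and> proper_map X Y f"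


section \<open>Topological groups and Weil completions\<close>

definition topological_group :: "('g, 'm) monoid_scheme \<Rightarrow> 'g topology \<Rightarrow> bool"
  where "topological_group G T \<longleftrightarrow> group G \<and> topspace T = carrier G
    \<and> continuous_map (prod_topology T T) T (\<lambda>(x, y). x \<otimes>\<^bsub>G\<^esub> y)
    \<and> continuous_map T T (\<lambda>x. inv\<^bsub>G\<^esub> x)"

definition left_uniformity :: "('g, 'm) monoid_scheme \<Rightarrow> 'g topology \<Rightarrow> ('g \<times> 'g) filter"
  where "left_uniformity G T = (INF U\<in>{U. openin T U \<and> \<one>\<^bsub>G\<^esub> \<in> U}.
    principal {(x, y). x \<in> carrier G \<and> y \<in> carrier G \<and> inv\<^bsub>G\<^esub> x \<otimes>\<^bsub>G\<^esub> y \<in> U})"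

definition left_complete :: "('g, 'm) monoid_scheme \<Rightarrow> 'g topology \<Rightarrow> bool"
  where "left_complete G T \<longleftrightarrow>
    (\<forall>F. F \<noteq> bot \<and> F \<times>\<^sub>F F \<le> left_uniformity G T \<longrightarrow> (\<exists>l. limitin T id l F))"

text \<open>Following Bourbaki, complete groups are required to be Hausdorff.\<close>

definition weil_completion ::
  "('g, 'm) monoid_scheme \<Rightarrow> 'g topology \<Rightarrow> ('k, 'n) monoid_scheme \<Rightarrow> 'k topology \<Rightarrow> ('g \<Rightarrow> 'k) \<Rightarrow> bool"
  where "weil_completion G T K S \<phi> \<longleftrightarrow>
    topological_group K S \<and> Hausdorff_space S \<and> left_complete K S
    \<and> \<phi> \<in> hom G K \<and> embedding_map T S \<phi> \<and> S closure_of (\<phi> ` carrier G) = topspace S"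

text \<open>
  The carrier type of the completion has to be fixed. Sets of subsets of \<open>'g\<close> are enough, because
  a point of the completion is determined by the traces of its neighbourhoods on the dense
  subgroup; \<open>has_weil_completionI\<close> shows that a completion on any other type can be transported.
\<close>

definition has_weil_completion :: "('g, 'm) monoid_scheme \<Rightarrow> 'g topology \<Rightarrow> bool"
  where "has_weil_completion G T \<longleftrightarrow>
    (\<exists>(K :: 'g set set monoid) S \<phi>. weil_completion G T K S \<phi>)"

lemma has_weil_completionI:
  fixes G :: "('g, 'm) monoid_scheme" and K :: "('k, 'n) monoid_scheme"
  assumes "weil_completion G T K S \<phi>"
  shows "has_weil_completion G T"
proof -
  note W = assms[unfolded weil_completion_def topological_group_def]
  interpret K: group K using W by blast
  have top: "topspace S = carrier K" using W by blast
  define e :: "'k \<Rightarrow> 'g set set" where "e k = {\<phi> -` U \<inter> carrier G |U. openin S U \<and> k \<in> U}" for k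
  have inj: "inj_on e (carrier K)"
  proof (rule inj_onI, rule ccontr)
    fix k l assume kl: "k \<in> carrier K" "l \<in> carrier K" "e k = e l" "k \<noteq> l"
    then obtain U V where UV: "openin S U" "openin S V" "k \<in> U" "l \<in> V" "disjnt U V"
      using W top unfolding Hausdorff_space_def by metis
    then have "\<phi> -` U \<inter> carrier G \<in> e l" using kl(3) unfolding e_def by blast
    then obtain X where X: "openin S X" "l \<in> X" "\<phi> -` U \<inter> carrier G = \<phi> -` X \<inter> carrier G"
      unfolding e_def by blast
    have "l \<in> S closure_of (\<phi> ` carrier G)" using W kl(2) top by simp
    moreover have "openin S (V \<inter> X)" "l \<in> V \<inter> X" using UV X by auto
    ultimately obtain y where "y \<in> carrier G" "\<phi> y \<in> V \<inter> X" unfolding in_closure_of by blast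
    then have "\<phi> y \<in> U" using X(3) by blast
    then show False using UV(5) \<open>\<phi> y \<in> V \<inter> X\<close> by (auto simp: disjnt_iff)
  qed
  define r where "r = inv_into (carrier K) e"
  have re: "r (e x) = x" if "x \<in> carrier K" for x using inj that by (simp add: r_def)
  define L :: "'g set set monoid" where
    "L = \<lparr>carrier = e ` carrier K, monoid.mult = (\<lambda>a b. e (r a \<otimes>\<^bsub>K\<^esub> r b)), one = e \<one>\<^bsub>K\<^esub>\<rparr>"
  define S' where "S' = pullback_topology (e ` carrier K) r S"
  have top': "topspace S' = carrier L"
    using top by (auto simp: S'_def L_def topspace_pullback_topology re)
  have hom: "e \<in> hom K L" by (rule homI) (auto simp: L_def re)
  have r_hom: "r \<in> hom L K" by (rule homI) (auto simp: L_def re)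
  have er: "e (r a) = a" if "a \<in> carrier L" for a using that by (auto simp: L_def re)
  have oL: "\<one>\<^bsub>L\<^esub> = e \<one>\<^bsub>K\<^esub>" and cL: "carrier L = e ` carrier K"
    and mL: "x \<otimes>\<^bsub>L\<^esub> y = e (r x \<otimes>\<^bsub>K\<^esub> r y)" for x y by (simp_all add: L_def)
  have grp: "group L"
  proof -
    have "L\<lparr>carrier := e ` carrier K, one := e \<one>\<^bsub>K\<^esub>\<rparr> = L" by (simp add: L_def)
    then show ?thesis using K.hom_imp_img_group[OF hom] by metis
  qed
  have cr: "continuous_map S' S r"
    unfolding S'_def by (rule continuous_map_pullback[of S S id, simplified])
  have "openin S {x \<in> carrier K. e x \<in> V}" if V: "openin S' V" for V
  proof -
    obtain U where U: "openin S U" "V = r -` U \<inter> e ` carrier K"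
      using V unfolding S'_def openin_pullback_topology by blast
    have "U \<subseteq> carrier K" using openin_subset[OF U(1)] top by simp
    then have "{x \<in> carrier K. e x \<in> V} = U" unfolding U(2) using re by auto
    then show ?thesis using U(1) by simp
  qed
  then have ce: "continuous_map S S' e"
    using top top' cL by (auto simp: continuous_map_def)
  have hm: "homeomorphic_maps S S' e r"
    unfolding homeomorphic_maps_def using cr ce top top' er re by simp
  have hme: "homeomorphic_map S S' e" using hm homeomorphic_map_maps by blast
  have "embedding_map S S' e"
    using hme homeomorphic_imp_surjective_map[OF hme] by (simp add: embedding_map_def)
  then have emb: "embedding_map T S' (e \<circ> \<phi>)"
    using W embedding_map_compose by blast
  have haus: "Hausdorff_space S'"
    using W homeomorphic_Hausdorff_space homeomorphic_map_imp_homeomorphic_space[OF hme] by blast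
  have dense: "S' closure_of ((e \<circ> \<phi>) ` carrier G) = topspace S'"
  proof -
    have "\<phi> ` carrier G \<subseteq> topspace S" using W top by (auto simp: hom_def)
    then have "S' closure_of (e ` (\<phi> ` carrier G)) = e ` (S closure_of (\<phi> ` carrier G))"
      by (rule homeomorphic_map_closure_of[OF hme])
    also have "\<dots> = topspace S'" using W top top' cL by simp
    finally show ?thesis by (simp add: image_comp)
  qed
  have homG: "e \<circ> \<phi> \<in> hom G L" using W hom hom_compose by blast
  interpret L: group L by (rule grp)
  interpret r: group_hom L K r using r_hom by (simp add: group_hom_def group_hom_axioms_def L.is_group K.is_group)
  have inv: "inv\<^bsub>L\<^esub> x = e (inv\<^bsub>K\<^esub> (r x))" if "x \<in> carrier L" for x
    using er[of "inv\<^bsub>L\<^esub> x"] that by (metis L.inv_closed r.hom_inv)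
  have multK: "continuous_map (prod_topology S S) S (\<lambda>(x, y). x \<otimes>\<^bsub>K\<^esub> y)"
    and invK: "continuous_map S S (\<lambda>x. inv\<^bsub>K\<^esub> x)" using W by blast+
  have tg: "topological_group L S'"
    unfolding topological_group_def
  proof (intro conjI grp top')
    have "continuous_map (prod_topology S' S') (prod_topology S S) (\<lambda>(x, y). (r x, r y))"
      using cr by (simp add: continuous_map_prod_top)
    then have "continuous_map (prod_topology S' S') S'
        (e \<circ> (\<lambda>(x, y). x \<otimes>\<^bsub>K\<^esub> y) \<circ> (\<lambda>(x, y). (r x, r y)))"
      using multK ce by (intro continuous_map_compose)
    then show "continuous_map (prod_topology S' S') S' (\<lambda>(x, y). x \<otimes>\<^bsub>L\<^esub> y)"
      by (rule continuous_map_eq) (simp add: mL split: prod.splits)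
    have "continuous_map S' S' (e \<circ> (\<lambda>x. inv\<^bsub>K\<^esub> x) \<circ> r)"
      using cr invK ce by (intro continuous_map_compose)
    then show "continuous_map S' S' (\<lambda>x. inv\<^bsub>L\<^esub> x)"
      by (rule continuous_map_eq) (simp add: top' inv)
  qed
  have compl: "left_complete L S'"
    unfolding left_complete_def
  proof (intro allI impI, elim conjE)
    fix F assume F: "F \<noteq> bot" "F \<times>\<^sub>F F \<le> left_uniformity L S'"
    have ev: "eventually (\<lambda>(x, y). x \<in> carrier L \<and> y \<in> carrier L \<and> inv\<^bsub>L\<^esub> x \<otimes>\<^bsub>L\<^esub> y \<in> V) (F \<times>\<^sub>F F)"
      if V: "openin S' V" "\<one>\<^bsub>L\<^esub> \<in> V" for V
    proof -
      have "left_uniformity L S' \<le> principal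
          {(x, y). x \<in> carrier L \<and> y \<in> carrier L \<and> inv\<^bsub>L\<^esub> x \<otimes>\<^bsub>L\<^esub> y \<in> V}"
        unfolding left_uniformity_def by (rule INF_lower) (simp add: V)
      with F(2) have "F \<times>\<^sub>F F \<le> principal
          {(x, y). x \<in> carrier L \<and> y \<in> carrier L \<and> inv\<^bsub>L\<^esub> x \<otimes>\<^bsub>L\<^esub> y \<in> V}"
        by (rule order_trans)
      then show ?thesis by (simp add: le_principal case_prod_unfold)
    qed
    have "filtermap r F \<times>\<^sub>F filtermap r F \<le> left_uniformity K S"
      unfolding left_uniformity_def
    proof (rule INF_greatest)
      fix U assume "U \<in> {U. openin S U \<and> \<one>\<^bsub>K\<^esub> \<in> U}"
      then have U: "openin S U" "\<one>\<^bsub>K\<^esub> \<in> U" by auto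
      have "openin S' (e ` U)" using U(1) hme homeomorphic_map_openness openin_subset by metis
      moreover have "\<one>\<^bsub>L\<^esub> \<in> e ` U" using U(2) oL by blast
      ultimately have "eventually (\<lambda>(x, y). x \<in> carrier L \<and> y \<in> carrier L
          \<and> inv\<^bsub>L\<^esub> x \<otimes>\<^bsub>L\<^esub> y \<in> e ` U) (F \<times>\<^sub>F F)"
        by (rule ev)
      then have "eventually (\<lambda>(x, y). r x \<in> carrier K \<and> r y \<in> carrier K
          \<and> inv\<^bsub>K\<^esub> (r x) \<otimes>\<^bsub>K\<^esub> r y \<in> U) (F \<times>\<^sub>F F)"
      proof (rule eventually_mono, clarify)
        fix x y u assume xy: "x \<in> carrier L" "y \<in> carrier L" "inv\<^bsub>L\<^esub> x \<otimes>\<^bsub>L\<^esub> y = e u" "u \<in> U"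
        then have "r (e u) = inv\<^bsub>K\<^esub> (r x) \<otimes>\<^bsub>K\<^esub> r y" by (simp flip: xy(3))
        moreover have "u \<in> carrier K" using xy(4) openin_subset[OF U(1)] top by blast
        ultimately show "r x \<in> carrier K \<and> r y \<in> carrier K \<and> inv\<^bsub>K\<^esub> (r x) \<otimes>\<^bsub>K\<^esub> r y \<in> U"
          using xy re by auto
      qed
      then show "filtermap r F \<times>\<^sub>F filtermap r F \<le> principal
          {(x, y). x \<in> carrier K \<and> y \<in> carrier K \<and> inv\<^bsub>K\<^esub> x \<otimes>\<^bsub>K\<^esub> y \<in> U}"
        by (simp add: le_principal case_prod_unfold filtermap_prod_filter[symmetric] eventually_filtermap
            map_prod_def)
    qed
    then obtain l where l: "limitin S id l (filtermap r F)"
      using W F(1) unfolding left_complete_def by (metis filtermap_bot_iff)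
    then have "limitin S r l F" by (simp add: limitin_def eventually_filtermap)
    then have "limitin S' (e \<circ> r) (e l) F" by (rule continuous_map_limit[OF ce])
    moreover have "eventually (\<lambda>x. x \<in> carrier L) F"
    proof -
      have "eventually (\<lambda>(x, y). x \<in> carrier L \<and> y \<in> carrier L
          \<and> inv\<^bsub>L\<^esub> x \<otimes>\<^bsub>L\<^esub> y \<in> topspace S') (F \<times>\<^sub>F F)"
        by (rule ev, rule openin_topspace) (simp add: top')
      then obtain P Q where PQ: "eventually P F" "eventually Q F"
          "\<And>x y. P x \<Longrightarrow> Q y \<Longrightarrow> x \<in> carrier L"
        unfolding eventually_prod_filter by blast
      obtain y where "Q y" using PQ(2) F(1) eventually_happens' by blast
      with PQ(3) have "P x \<Longrightarrow> x \<in> carrier L" for x by blast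
      with PQ(1) show ?thesis by (rule eventually_mono)
    qed
    ultimately have "limitin S' id (e l) F"
      by (elim limitin_transform_eventually[rotated]) (auto simp: er elim: eventually_mono)
    then show "\<exists>l. limitin S' id l F" by blast
  qed
  show ?thesis
    unfolding has_weil_completion_def weil_completion_def
    by (intro exI conjI) (fact tg haus compl homG emb dense)+
qed

end

theory Submission
  imports Defs
begin

text \<open>
  All elements of \<open>E\<close> preserve distances, so composition is jointly continuous on \<open>E\<close> and a limit of
  maps in \<open>E\<close> is inverted by any limit of their inverses. If the map \<open>\<omega>\<close> is proper and
  \<open>g\<^sub>n \<rightarrow> f\<close> with \<open>g\<^sub>n \<rightarrow> \<infinity>\<close>, then \<open>(g\<^sub>n\<inverse>, f x)\<close> has the convergent image \<open>(f x, g\<^sub>n\<inverse> (f x)) \<rightarrow> (f x, x)\<close>,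
  so the \<open>g\<^sub>n\<inverse>\<close> cluster at an inverse of \<open>f\<close>. Conversely, when \<open>E\<close> is a group, properness amounts to
  the statement that a net in \<open>E\<close> has a convergent subnet as soon as it converges at one point of
  \<open>X \<union> X\<^sub>l\<close>; approximating it by isometries of \<open>X\<close>, this is Cauchy-indivisibility at points of \<open>X\<close>.
  For the Weil completion, the left Cauchy filters on the isometry group are the pointwise Cauchy ones,
  and a completion exists only if inversion preserves them.
\<close>

section \<open>Pointwise convergence and Cauchy filters\<close>

lemma tendsto_fun_iff:
  fixes f :: "'i \<Rightarrow> 'a \<Rightarrow> 'b::topological_space"
  shows "(f \<longlongrightarrow> l) F \<longleftrightarrow> (\<forall>x. ((\<lambda>i. f i x) \<longlongrightarrow> l x) F)"
  using limitin_componentwise[of "\<lambda>_. euclidean :: 'b topology" UNIV f l F]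
  by (simp add: euclidean_product_topology)

lemma cauchy_filter_imp_tendsto:
  fixes f :: "'i \<Rightarrow> 'b::complete_space"
  assumes "cauchy_filter (filtermap f F)" "F \<noteq> bot"
  obtains l where "(f \<longlongrightarrow> l) F"
  using cauchy_filter_complete_converges[OF assms(1) complete_UNIV] assms(2)
  by (auto simp: filtermap_bot_iff filterlim_def)

lemma tendsto_imp_cauchy_filter:
  fixes f :: "'i \<Rightarrow> 'b::metric_space"
  assumes "(f \<longlongrightarrow> l) F"
  shows "cauchy_filter (filtermap f F)"
  using assms by (simp add: filterlim_def nhds_imp_cauchy_filter)

text \<open>Turns Cauchyness into a null limit along the product filter, so that estimates become
  limit calculus with two independent indices.\<close>

lemma cauchy_filter_filtermap_iff_tendsto:
  fixes f :: "'i \<Rightarrow> 'b::metric_space"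
  shows "cauchy_filter (filtermap f F) \<longleftrightarrow> ((\<lambda>(i, j). dist (f i) (f j)) \<longlongrightarrow> 0) (F \<times>\<^sub>F F)"
proof -
  have "((\<lambda>(i, j). dist (f i) (f j)) \<longlongrightarrow> 0) (F \<times>\<^sub>F F)
      \<longleftrightarrow> (\<forall>e>0. eventually (\<lambda>(i, j). dist (f i) (f j) < e) (F \<times>\<^sub>F F))"
    by (simp add: tendsto_iff case_prod_unfold)
  then show ?thesis
    unfolding cauchy_filter_metric_filtermap eventually_prod_same by fastforce
qed

text \<open>The triangle inequality through \<open>u i\<close> and \<open>u j\<close> bounds
  \<open>dist (v i) (v j)\<close> by three terms that tend to 0.\<close>

lemma cauchy_filter_close:
  fixes u v :: "'i \<Rightarrow> 'b::metric_space"
  assumes u: "cauchy_filter (filtermap u F)"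
    and close: "((\<lambda>i. dist (u i) (v i)) \<longlongrightarrow> 0) F"
  shows "cauchy_filter (filtermap v F)"
proof -
  have "((\<lambda>p. dist (u (fst p)) (v (fst p)) + dist (u (fst p)) (u (snd p)) + dist (u (snd p)) (v (snd p)))
      \<longlongrightarrow> 0 + 0 + 0) (F \<times>\<^sub>F F)"
    using u unfolding cauchy_filter_filtermap_iff_tendsto case_prod_unfold
    by (intro tendsto_add filterlim_compose[OF close filterlim_fst]
        filterlim_compose[OF close filterlim_snd])
  moreover have "norm (case p of (i, j) \<Rightarrow> dist (v i) (v j))
      \<le> dist (u (fst p)) (v (fst p)) + dist (u (fst p)) (u (snd p)) + dist (u (snd p)) (v (snd p))" for p
    using dist_triangle[of "v (fst p)" "v (snd p)" "u (fst p)"] dist_triangle[of "u (fst p)" "v (snd p)" "u (snd p)"]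
    by (simp add: case_prod_unfold dist_commute)
  ultimately show ?thesis
    unfolding cauchy_filter_filtermap_iff_tendsto
    using Lim_null_comparison[OF always_eventually] by fastforce
qed

lemma tendsto_close:
  fixes u v :: "'i \<Rightarrow> 'b::metric_space"
  assumes u: "(u \<longlongrightarrow> l) F" and close: "((\<lambda>i. dist (u i) (v i)) \<longlongrightarrow> 0) F"
  shows "(v \<longlongrightarrow> l) F"
proof -
  have "((\<lambda>i. dist (u i) (v i) + dist (u i) l) \<longlongrightarrow> 0) F"
    using tendsto_add[OF close, of "\<lambda>i. dist (u i) l" 0] u by (simp add: tendsto_dist_iff[symmetric])
  moreover have "norm (dist (v i) l) \<le> dist (u i) (v i) + dist (u i) l" for i
    using dist_triangle[of "v i" l "u i"] by (simp add: dist_commute)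
  ultimately have "((\<lambda>i. dist (v i) l) \<longlongrightarrow> 0) F"
    using Lim_null_comparison[OF always_eventually] by fastforce
  then show ?thesis by (simp add: tendsto_dist_iff[symmetric])
qed

section \<open>Distance-preserving maps\<close>

definition dist_preserving :: "('a::metric_space \<Rightarrow> 'b::metric_space) \<Rightarrow> bool"
  where "dist_preserving f \<longleftrightarrow> (\<forall>x y. dist (f x) (f y) = dist x y)"

lemma dist_preservingD: "dist_preserving f \<Longrightarrow> dist (f x) (f y) = dist x y"
  by (simp add: dist_preserving_def)

lemma dist_preserving_continuous: "dist_preserving f \<Longrightarrow> continuous_on S f"
  by (auto simp: continuous_on_iff dist_preserving_def)

text \<open>Each instance of the condition involves only two coordinates of \<open>f\<close>, so the
  set is an intersection of closed sets. Surjectivity, by contrast, can be lost in a pointwise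
  limit, which is why the Ellis semigroup may fail to be a group.\<close>

lemma closed_dist_preserving:
  "closed {f :: 'a::metric_space \<Rightarrow> 'b::metric_space. dist_preserving f}"
  unfolding dist_preserving_def
  by (intro closed_Collect_all closed_Collect_eq continuous_intros continuous_on_product_coordinates)

text \<open>By equicontinuity evaluation is jointly continuous: moving the argument from
  \<open>z\<close> to \<open>y i\<close> costs exactly \<open>dist (y i) z\<close>, whichever map is
  applied.\<close>

lemma dist_preserving_tendsto:
  assumes "(f \<longlongrightarrow> l) F" "eventually (\<lambda>i. dist_preserving (f i)) F" "(y \<longlongrightarrow> z) F"
  shows "((\<lambda>i. f i (y i)) \<longlongrightarrow> l z) F"
proof -
  have "((\<lambda>i. dist (f i z) (l z)) \<longlongrightarrow> 0) F"
    using assms(1) by (simp add: tendsto_fun_iff tendsto_dist_iff[symmetric])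
  moreover have "((\<lambda>i. dist (y i) z) \<longlongrightarrow> 0) F"
    using assms(3) by (simp add: tendsto_dist_iff[symmetric])
  ultimately have "((\<lambda>i. dist (y i) z + dist (f i z) (l z)) \<longlongrightarrow> 0) F"
    using tendsto_add by fastforce
  moreover have "eventually (\<lambda>i. norm (dist (f i (y i)) (l z)) \<le> dist (y i) z + dist (f i z) (l z)) F"
    using assms(2) by eventually_elim (simp, metis dist_preservingD dist_triangle)
  ultimately have "((\<lambda>i. dist (f i (y i)) (l z)) \<longlongrightarrow> 0) F"
    by (rule Lim_null_comparison[rotated])
  then show ?thesis by (simp add: tendsto_dist_iff[symmetric])
qed

lemma dist_preserving_tendsto_comp:
  assumes "(f \<longlongrightarrow> l) F" "eventually (\<lambda>i. dist_preserving (f i)) F" "(h \<longlongrightarrow> k) F"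
  shows "((\<lambda>i. f i \<circ> h i) \<longlongrightarrow> (l \<circ> k)) F"
  unfolding tendsto_fun_iff o_def
  using dist_preserving_tendsto[OF assms(1,2)] assms(3) by (simp add: tendsto_fun_iff)

text \<open>Replacing \<open>y\<close> by a nearby point of \<open>D\<close> changes all values
  \<open>f i y\<close> by the same small distance, so three errors of size \<open>e / 3\<close>
  suffice.\<close>

lemma dist_preserving_cauchy_on_dense:
  fixes f :: "'i \<Rightarrow> 'a::metric_space \<Rightarrow> 'b::metric_space"
  assumes dp: "eventually (\<lambda>i. dist_preserving (f i)) F" and dense: "closure D = UNIV"
    and D: "\<And>x. x \<in> D \<Longrightarrow> cauchy_filter (filtermap (\<lambda>i. f i x) F)"
  shows "cauchy_filter (filtermap (\<lambda>i. f i y) F)"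
  unfolding cauchy_filter_metric_filtermap
proof (intro allI impI)
  fix e :: real assume "e > 0"
  then obtain x where x: "x \<in> D" "dist x y < e / 3"
    using dense by (metis UNIV_I closure_approachable divide_pos_pos zero_less_numeral)
  obtain P where P: "eventually P F" "\<And>i j. P i \<Longrightarrow> P j \<Longrightarrow> dist (f i x) (f j x) < e / 3"
    using D[OF x(1)] \<open>e > 0\<close> unfolding cauchy_filter_metric_filtermap
    by (metis divide_pos_pos zero_less_numeral)
  have "dist (f i y) (f j y) < e"
    if "P i" "dist_preserving (f i)" "P j" "dist_preserving (f j)" for i j
    using P(2)[OF that(1,3)] x(2) dist_preservingD[OF that(2), of x y] dist_preservingD[OF that(4), of x y]
      dist_triangle[of "f i y" "f j y" "f i x"] dist_triangle[of "f i x" "f j y" "f j x"]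
    by (simp add: dist_commute)
  then show "\<exists>P. eventually P F \<and> (\<forall>i j. P i \<and> P j \<longrightarrow> dist (f i y) (f j y) < e)"
    by (intro exI[of _ "\<lambda>i. P i \<and> dist_preserving (f i)"]) (auto intro: eventually_conj P(1) dp)
qed

text \<open>Completeness of the target gives a limit at every point; the limit map is assembled from
  these values.\<close>

lemma dist_preserving_tendsto_exists:
  fixes f :: "'i \<Rightarrow> 'a::metric_space \<Rightarrow> 'b::complete_space"
  assumes "F \<noteq> bot" "eventually (\<lambda>i. dist_preserving (f i)) F" "closure D = UNIV"
    and "\<And>x. x \<in> D \<Longrightarrow> cauchy_filter (filtermap (\<lambda>i. f i x) F)"
  obtains l where "(f \<longlongrightarrow> l) F"
proof -
  have "\<exists>l. ((\<lambda>i. f i y) \<longlongrightarrow> l) F" for y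
    using cauchy_filter_imp_tendsto[OF dist_preserving_cauchy_on_dense[OF assms(2-4)] assms(1)] by blast
  then show thesis using that unfolding tendsto_fun_iff by metis
qed


section \<open>Isometry groups\<close>

lemma isometries_dist: "g \<in> isometries \<Longrightarrow> dist (g x) (g y) = dist x y"
  by (simp add: isometries_def)

lemma isometries_bij: "g \<in> isometries \<Longrightarrow> bij g"
  unfolding isometries_def bij_def inj_def by (metis (mono_tags, lifting) dist_eq_0_iff mem_Collect_eq)

lemma isometries_comp: "g \<in> isometries \<Longrightarrow> h \<in> isometries \<Longrightarrow> g \<circ> h \<in> isometries"
  using comp_surj[of h g] by (simp add: isometries_def)

lemma isometries_id: "id \<in> isometries"
  by (simp add: isometries_def)

lemma isometries_inv:
  assumes "g \<in> isometries"
  shows "inv_into UNIV g \<in> isometries" "inv_into UNIV g (g x) = x" "g (inv_into UNIV g x) = x"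
proof -
  have b: "bij g" using assms by (rule isometries_bij)
  show 1: "inv_into UNIV g (g x) = x" for x using b by (simp add: bij_is_inj)
  show 2: "g (inv_into UNIV g x) = x" for x using b by (simp add: bij_is_surj surj_f_inv_f)
  have "dist (inv_into UNIV g x) (inv_into UNIV g y) = dist x y" for x y
    using isometries_dist[OF assms, of "inv_into UNIV g x" "inv_into UNIV g y"] by (simp add: 2)
  moreover have "surj (inv_into UNIV g)" by (metis 1 surjI)
  ultimately show "inv_into UNIV g \<in> isometries" by (simp add: isometries_def)
qed

lemma map_monoid_simps [simp]:
  "carrier (map_monoid S) = S" "f \<otimes>\<^bsub>map_monoid S\<^esub> g = f \<circ> g" "\<one>\<^bsub>map_monoid S\<^esub> = id"
  by (simp_all add: map_monoid_def)

lemma group_map_monoid_iff: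
  assumes "id \<in> S" "\<And>f g. f \<in> S \<Longrightarrow> g \<in> S \<Longrightarrow> f \<circ> g \<in> S"
  shows "group (map_monoid S) \<longleftrightarrow> (\<forall>f\<in>S. \<exists>h\<in>S. h \<circ> f = id \<and> f \<circ> h = id)"
proof
  assume "group (map_monoid S)"
  then interpret group "map_monoid S" .
  show "\<forall>f\<in>S. \<exists>h\<in>S. h \<circ> f = id \<and> f \<circ> h = id"
    using inv_closed l_inv r_inv by force
next
  assume "\<forall>f\<in>S. \<exists>h\<in>S. h \<circ> f = id \<and> f \<circ> h = id"
  then show "group (map_monoid S)"
    using assms by (intro groupI) (auto simp: o_assoc)
qed

lemma group_isometries: "group (map_monoid (isometries :: ('a::metric_space \<Rightarrow> 'a) set))"
proof (rule group_map_monoid_iff[THEN iffD2])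
  show "\<forall>f\<in>isometries :: ('a \<Rightarrow> 'a) set. \<exists>h\<in>isometries. h \<circ> f = id \<and> f \<circ> h = id"
  proof
    fix f :: "'a \<Rightarrow> 'a" assume "f \<in> isometries"
    from isometries_inv[OF this] show "\<exists>h\<in>isometries. h \<circ> f = id \<and> f \<circ> h = id"
      by (intro bexI[of _ "inv_into UNIV f"]) (auto simp: fun_eq_iff)
  qed
qed (auto simp: isometries_id isometries_comp)

lemma inv_map_monoid:
  assumes "group (map_monoid S)" "f \<in> S" "h \<in> S" "h \<circ> f = id"
  shows "inv\<^bsub>map_monoid S\<^esub> f = h"
proof -
  interpret group "map_monoid S" by (rule assms)
  show ?thesis using inv_equality[of h f] assms by simp
qed

lemma topological_group_map_monoid:
  assumes G: "group (map_monoid S)" and dp: "\<And>f. f \<in> S \<Longrightarrow> dist_preserving f"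
  shows "topological_group (map_monoid S) (top_of_set S)"
proof -
  interpret group "map_monoid S" by (rule G)
  define J where "J f = inv\<^bsub>map_monoid S\<^esub> f" for f
  have inv: "J f \<in> S" "f (J f x) = x" "J f (f x) = x" if "f \<in> S" for f x
    using inv_closed[of f] r_inv[of f] l_inv[of f] that by (simp_all add: J_def fun_eq_iff)
  have "continuous_on (S \<times> S) (\<lambda>p. fst p \<circ> snd p)"
    unfolding continuous_on_def
  proof
    fix p assume p: "p \<in> S \<times> S"
    show "((\<lambda>p. fst p \<circ> snd p) \<longlongrightarrow> (fst p \<circ> snd p)) (at p within S \<times> S)"
      by (intro dist_preserving_tendsto_comp tendsto_fst tendsto_snd tendsto_ident_at)
        (auto simp: eventually_at_filter dp intro!: always_eventually)
  qed
  moreover have "continuous_on S J"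
    unfolding continuous_on_def tendsto_fun_iff
  proof (intro ballI allI)
    fix f x assume f: "f \<in> S"
    \<comment> \<open>Since \<open>k\<close> preserves distances, \<open>J k x\<close> is as far
      from \<open>?y\<close> as \<open>x\<close> is from \<open>k ?y\<close>. Convergence of the
      inverses at \<open>x\<close> is thus convergence of \<open>k\<close> itself at the fixed point
      \<open>?y\<close>.\<close>
    let ?y = "J f x"
    have "((\<lambda>k. k ?y) \<longlongrightarrow> f ?y) (at f within S)"
      using tendsto_ident_at[of f S] by (simp add: tendsto_fun_iff)
    then have "((\<lambda>k. dist (k ?y) x) \<longlongrightarrow> 0) (at f within S)"
      using inv(2)[OF f] by (simp add: tendsto_dist_iff[symmetric])
    moreover have "eventually (\<lambda>k. dist (k ?y) x = dist (J k x) ?y) (at f within S)"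
      unfolding eventually_at_filter
    proof (intro always_eventually allI impI)
      fix k assume "k \<in> S"
      then show "dist (k ?y) x = dist (J k x) ?y"
        using dist_preservingD[OF dp, of k ?y "J k x"] inv(2)[of k x] by (simp add: dist_commute)
    qed
    ultimately have "((\<lambda>k. dist (J k x) ?y) \<longlongrightarrow> 0) (at f within S)"
      by (rule Lim_transform_eventually)
    then show "((\<lambda>k. J k x) \<longlongrightarrow> ?y) (at f within S)"
      by (simp add: tendsto_dist_iff[symmetric])
  qed
  moreover have "f \<circ> g \<in> S" if "f \<in> S" "g \<in> S" for f g using m_closed[of f g] that by simp
  ultimately show ?thesis
    unfolding topological_group_def using G inv(1)
    by (auto simp: continuous_map_in_subtopology case_prod_unfold simp flip: J_def)
qed


section \<open>The Ellis semigroup\<close>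

lemma hat_apply:
  assumes "completion_embedding \<iota>" "g \<in> isometries"
  shows "hat \<iota> g (\<iota> x) = \<iota> (g x)" and "continuous_on UNIV (hat \<iota> g)"
  using theI'[OF hat_unique_existence[OF assms]] unfolding hat_def by auto

lemma hat_unique:
  assumes "completion_embedding \<iota>" "g \<in> isometries" "continuous_on UNIV f" "\<And>x. f (\<iota> x) = \<iota> (g x)"
  shows "hat \<iota> g = f"
  unfolding hat_def using hat_unique_existence[OF assms(1,2)] assms(3,4) by (intro the1_equality) auto

context
  fixes \<iota> :: "'a::metric_space \<Rightarrow> 'b::complete_space"
  assumes emb: "completion_embedding \<iota>"
begin

lemma embedding_dist: "dist (\<iota> x) (\<iota> y) = dist x y"
  and embedding_dense: "closure (range \<iota>) = UNIV"
  using emb by (simp_all add: completion_embedding_def)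

lemma embedding_inj: "\<iota> x = \<iota> y \<longleftrightarrow> x = y"
  using embedding_dist[of x y] by (metis dist_eq_0_iff)

lemma embedding_cauchy:
  "cauchy_filter (filtermap (\<lambda>i. \<iota> (f i)) F) \<longleftrightarrow> cauchy_filter (filtermap f F)"
  by (simp add: cauchy_filter_metric_filtermap embedding_dist)

lemma embedding_tendsto: "((\<lambda>i. \<iota> (f i)) \<longlongrightarrow> \<iota> l) F \<longleftrightarrow> (f \<longlongrightarrow> l) F"
  by (simp add: tendsto_iff embedding_dist)

text \<open>Equicontinuity again: convergence on the dense image of X carries over to the completion
  by an \<open>e / 3\<close> estimate.\<close>

lemma dist_preserving_tendsto_on_range:
  assumes ev: "eventually (\<lambda>i. dist_preserving (f i)) F" and l: "dist_preserving l"
    and lim: "\<And>x. ((\<lambda>i. f i (\<iota> x)) \<longlongrightarrow> l (\<iota> x)) F"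
  shows "(f \<longlongrightarrow> l) F"
  unfolding tendsto_fun_iff
proof (intro allI tendstoI)
  fix y :: 'b and e :: real assume "e > 0"
  then have e3: "e / 3 > 0" by simp
  then obtain x where x: "dist (\<iota> x) y < e / 3"
    using embedding_dense by (metis (no_types, lifting) UNIV_I closure_approachable rangeE)
  have "eventually (\<lambda>i. dist (f i (\<iota> x)) (l (\<iota> x)) < e / 3) F"
    using lim e3 by (rule tendstoD)
  with ev show "eventually (\<lambda>i. dist (f i y) (l y) < e) F"
  proof eventually_elim
    case (elim i)
    then show ?case
      using x dist_preservingD[OF elim(1), of "\<iota> x" y] dist_preservingD[OF l, of "\<iota> x" y]
        dist_triangle[of "f i y" "l y" "f i (\<iota> x)"] dist_triangle[of "f i (\<iota> x)" "l y" "l (\<iota> x)"]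
      by (simp add: dist_commute)
  qed
qed

lemma hat_dist_preserving:
  assumes "g \<in> isometries"
  shows "dist_preserving (hat \<iota> g)"
proof -
  note c = continuous_on_compose2[OF hat_apply(2)[OF emb assms]]
  \<comment> \<open>The pairs whose distance is preserved form a closed set containing the dense set
    \<open>range \<iota> \<times> range \<iota>\<close>.\<close>
  have "closed {p. dist (hat \<iota> g (fst p)) (hat \<iota> g (snd p)) = dist (fst p) (snd p)}"
    by (intro closed_Collect_eq continuous_on_dist c continuous_intros) auto
  moreover have "range \<iota> \<times> range \<iota>
      \<subseteq> {p. dist (hat \<iota> g (fst p)) (hat \<iota> g (snd p)) = dist (fst p) (snd p)}"
    by (auto simp: hat_apply[OF emb assms] embedding_dist isometries_dist[OF assms])
  ultimately have "closure (range \<iota> \<times> range \<iota>)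
      \<subseteq> {p. dist (hat \<iota> g (fst p)) (hat \<iota> g (snd p)) = dist (fst p) (snd p)}"
    by (rule closure_minimal[rotated])
  then show ?thesis
    by (simp add: closure_Times embedding_dense dist_preserving_def subset_iff)
qed

lemma hat_comp:
  assumes "g \<in> isometries" "h \<in> isometries"
  shows "hat \<iota> (g \<circ> h) = hat \<iota> g \<circ> hat \<iota> h"
  using assms
  by (intro hat_unique emb isometries_comp continuous_on_compose continuous_on_subset[OF hat_apply(2)])
    (auto simp: hat_apply[OF emb])

lemma hat_id: "hat \<iota> id = id"
  by (intro hat_unique emb isometries_id) (simp_all add: continuous_on_id[unfolded id_def[symmetric]])

lemma hat_inverse:
  assumes "g \<in> isometries"
  shows "hat \<iota> (inv_into UNIV g) \<circ> hat \<iota> g = id" "hat \<iota> g \<circ> hat \<iota> (inv_into UNIV g) = id"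
proof -
  have "inv_into UNIV g \<circ> g = id" "g \<circ> inv_into UNIV g = id"
    using isometries_inv[OF assms] by (simp_all add: fun_eq_iff)
  then show "hat \<iota> (inv_into UNIV g) \<circ> hat \<iota> g = id" "hat \<iota> g \<circ> hat \<iota> (inv_into UNIV g) = id"
    by (simp_all add: hat_id isometries_inv(1) assms flip: hat_comp)
qed

lemma hat_inj: "inj_on (hat \<iota>) isometries"
  by (rule inj_onI, rule ext) (metis embedding_inj emb hat_apply(1))

text \<open>Makes \<open>hat\<close> a homeomorphism onto its image: one direction gives its
  continuity, the other that of its inverse.\<close>

lemma hat_tendsto_iff:
  assumes "eventually (\<lambda>i. g i \<in> isometries) F" "l \<in> isometries"
  shows "((\<lambda>i. hat \<iota> (g i)) \<longlongrightarrow> hat \<iota> l) F \<longleftrightarrow> (g \<longlongrightarrow> l) F"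
proof -
  have ev: "eventually (\<lambda>i. hat \<iota> (g i) (\<iota> x) = \<iota> (g i x)) F" for x
    using assms(1) by eventually_elim (rule hat_apply(1)[OF emb])
  have *: "((\<lambda>i. hat \<iota> (g i) (\<iota> x)) \<longlongrightarrow> hat \<iota> l (\<iota> x)) F \<longleftrightarrow> ((\<lambda>i. g i x) \<longlongrightarrow> l x) F" for x
    using tendsto_cong[OF ev] by (simp add: hat_apply(1)[OF emb assms(2)] embedding_tendsto)
  have "eventually (\<lambda>i. dist_preserving (hat \<iota> (g i))) F"
    using assms(1) by eventually_elim (rule hat_dist_preserving)
  from dist_preserving_tendsto_on_range[OF this hat_dist_preserving[OF assms(2)]]
  show ?thesis using * unfolding tendsto_fun_iff by metis
qed

text \<open>Pointwise limits of extensions preserve distances and are therefore continuous, so the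
  closure within the continuous maps is already the closure in the full function space.\<close>

lemma ellis_eq_closure: "ellis \<iota> = closure (hat \<iota> ` isometries)"
  and ellis_dist_preserving: "f \<in> ellis \<iota> \<Longrightarrow> dist_preserving f"
proof -
  have cl: "closure (hat \<iota> ` isometries) \<subseteq> {f. dist_preserving f}"
    by (intro closure_minimal closed_dist_preserving) (auto simp: hat_dist_preserving)
  have "hat \<iota> ` isometries \<subseteq> {f. continuous_on UNIV f}"
    by (auto simp: hat_apply(2)[OF emb])
  then have "ellis \<iota> = {f. continuous_on UNIV f} \<inter> closure (hat \<iota> ` isometries)"
    unfolding ellis_def closure_of_subtopology by (simp add: Int_absorb1)
  then show *: "ellis \<iota> = closure (hat \<iota> ` isometries)"
    using cl dist_preserving_continuous by blast
  show "f \<in> ellis \<iota> \<Longrightarrow> dist_preserving f"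
    using cl * by blast
qed

section \<open>Closure of the Ellis semigroup under limits and composition; its group
  structure\<close>

lemma closed_ellis: "closed (ellis \<iota>)"
  by (simp add: ellis_eq_closure)

lemma hat_in_ellis: "g \<in> isometries \<Longrightarrow> hat \<iota> g \<in> ellis \<iota>"
  using closure_subset[of "hat \<iota> ` isometries"] by (auto simp: ellis_eq_closure)

lemma id_in_ellis: "id \<in> ellis \<iota>"
  using hat_in_ellis[OF isometries_id] by (simp add: hat_id)

lemma ellis_tendsto:
  "(f \<longlongrightarrow> l) F \<Longrightarrow> F \<noteq> bot \<Longrightarrow> eventually (\<lambda>i. f i \<in> ellis \<iota>) F \<Longrightarrow> l \<in> ellis \<iota>"
  using Lim_in_closed_set[OF closed_ellis] by blast

text \<open>Two passages to the closure, one factor at a time: left composition with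
  \<open>hat \<iota> g\<close> is continuous because that map is, and right composition with a fixed
  \<open>h\<close> is continuous because it only permutes or selects coordinates.\<close>

lemma ellis_comp:
  assumes "f \<in> ellis \<iota>" "h \<in> ellis \<iota>"
  shows "f \<circ> h \<in> ellis \<iota>"
proof -
  have 1: "hat \<iota> g \<circ> k \<in> ellis \<iota>" if g: "g \<in> isometries" and k: "k \<in> ellis \<iota>" for g k
  proof -
    have "continuous_on (closure (hat \<iota> ` isometries)) (\<lambda>k. hat \<iota> g \<circ> k)"
      unfolding o_def
      by (intro continuous_on_coordinatewise_then_product
          continuous_on_compose2[OF hat_apply(2)[OF emb g]]
          continuous_on_subset[OF continuous_on_product_coordinates]) auto
    then have "(\<lambda>k. hat \<iota> g \<circ> k) ` closure (hat \<iota> ` isometries) \<subseteq> ellis \<iota>"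
      using closed_ellis g
      by (intro image_closure_subset) (auto simp flip: hat_comp intro!: hat_in_ellis isometries_comp)
    then show ?thesis using k by (auto simp: ellis_eq_closure)
  qed
  have "continuous_on (closure (hat \<iota> ` isometries)) (\<lambda>k. k \<circ> h)"
    unfolding o_def
    by (intro continuous_on_coordinatewise_then_product
        continuous_on_subset[OF continuous_on_product_coordinates]) auto
  then have "(\<lambda>k. k \<circ> h) ` closure (hat \<iota> ` isometries) \<subseteq> ellis \<iota>"
    using closed_ellis 1[OF _ assms(2)] by (intro image_closure_subset) auto
  then show ?thesis using assms(1) by (auto simp: ellis_eq_closure)
qed

lemma group_ellis_iff:
  "group (map_monoid (ellis \<iota>)) \<longleftrightarrow> (\<forall>f\<in>ellis \<iota>. \<exists>h\<in>ellis \<iota>. h \<circ> f = id \<and> f \<circ> h = id)"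
  by (intro group_map_monoid_iff id_in_ellis ellis_comp)

lemma topological_group_ellis:
  "group (map_monoid (ellis \<iota>)) \<Longrightarrow> topological_group (map_monoid (ellis \<iota>)) (top_of_set (ellis \<iota>))"
  by (rule topological_group_map_monoid[OF _ ellis_dist_preserving])

lemma divergent_limits_subset_ellis: "divergent_limits \<iota> \<subseteq> ellis \<iota>"
proof
  fix h assume "h \<in> divergent_limits \<iota>"
  then obtain g :: "nat \<Rightarrow> 'a \<Rightarrow> 'a"
    where "range g \<subseteq> isometries" "((\<lambda>n. hat \<iota> (g n)) \<longlongrightarrow> h) sequentially"
    unfolding divergent_limits_def by (auto simp: limitin_subtopology)
  then show "h \<in> ellis \<iota>"
    by (intro ellis_tendsto[of _ h sequentially]) (auto intro!: always_eventually hat_in_ellis)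
qed

text \<open>An inverse makes an Ellis map surjective, hence an isometry of the completion;
  \<open>isometries\<close> here consists of maps of the type \<open>'b\<close>. Closedness is
  inherited from the full function space.\<close>

lemma ellis_subgroup:
  assumes "group (map_monoid (ellis \<iota>))"
  shows "subgroup (ellis \<iota>) (map_monoid isometries) \<and> closedin (top_of_set isometries) (ellis \<iota>)"
proof -
  have inv: "\<exists>h\<in>ellis \<iota>. h \<circ> f = id \<and> f \<circ> h = id" if "f \<in> ellis \<iota>" for f
    using assms group_ellis_iff that by blast
  have sub: "ellis \<iota> \<subseteq> isometries"
  proof
    fix f assume f: "f \<in> ellis \<iota>"
    then have "surj f" using inv by (metis comp_apply id_apply surjI)
    then show "f \<in> isometries" using ellis_dist_preserving[OF f] by (simp add: isometries_def dist_preserving_def)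
  qed
  have "inv\<^bsub>map_monoid isometries\<^esub> f \<in> ellis \<iota>" if f: "f \<in> ellis \<iota>" for f
    using inv[OF f] inv_map_monoid[OF group_isometries] sub f by (metis subsetD)
  then have "subgroup (ellis \<iota>) (map_monoid isometries)"
    by (intro subgroup.intro) (auto simp: sub id_in_ellis ellis_comp subsetD[OF sub])
  moreover have "closedin (top_of_set isometries) (ellis \<iota>)"
    using closed_ellis sub by (simp add: closed_subset)
  ultimately show ?thesis ..
qed


subsection \<open>Weil completions\<close>

text \<open>For left completeness: closeness of \<open>f\<inverse> \<circ> g\<close> to the identity
  at \<open>y\<close> means closeness of \<open>f y\<close> and \<open>g y\<close>. Left Cauchy
  filters are therefore pointwise Cauchy, and their pointwise limits stay in the closed set
  E.\<close>

lemma weil_completion_ellis: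
  assumes G: "group (map_monoid (ellis \<iota>))"
  shows "weil_completion (map_monoid isometries) (top_of_set isometries)
    (map_monoid (ellis \<iota>)) (top_of_set (ellis \<iota>)) (hat \<iota>)"
  unfolding weil_completion_def
proof (intro conjI topological_group_ellis G)
  show "Hausdorff_space (top_of_set (ellis \<iota>))"
    using Hausdorff_space_product_topology[of "\<lambda>_. euclidean :: 'b topology" "UNIV :: 'b set"]
    by (intro Hausdorff_space_subtopology) (simp add: euclidean_product_topology)
  show "hat \<iota> \<in> hom (map_monoid isometries) (map_monoid (ellis \<iota>))"
    by (rule homI) (auto simp: hat_in_ellis hat_comp)
  show "top_of_set (ellis \<iota>) closure_of (hat \<iota> ` carrier (map_monoid isometries))
      = topspace (top_of_set (ellis \<iota>))"
    using hat_in_ellis by (simp add: closure_of_subtopology Int_absorb1 image_subset_iff flip: ellis_eq_closure)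
  show "embedding_map (top_of_set isometries) (top_of_set (ellis \<iota>)) (hat \<iota>)"
  proof -
    let ?r = "inv_into isometries (hat \<iota>)"
    have sub: "hat \<iota> ` isometries \<subseteq> ellis \<iota>" using hat_in_ellis by blast
    have r: "?r (hat \<iota> g) = g" if "g \<in> isometries" for g
      using hat_inj that by simp
    have "continuous_on isometries (hat \<iota>)"
      unfolding continuous_on_def
    proof
      fix g :: "'a \<Rightarrow> 'a" assume g: "g \<in> isometries"
      have "eventually (\<lambda>k. k \<in> isometries) (at g within isometries)"
        by (simp add: eventually_at_filter)
      from hat_tendsto_iff[OF this g] show "(hat \<iota> \<longlongrightarrow> hat \<iota> g) (at g within isometries)"
        by (simp add: tendsto_ident_at)
    qed
    moreover have "continuous_on (hat \<iota> ` isometries) ?r"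
      unfolding continuous_on_def
    proof
      fix k assume k: "k \<in> hat \<iota> ` isometries"
      let ?F = "at k within hat \<iota> ` isometries"
      have ev: "eventually (\<lambda>k. ?r k \<in> isometries) ?F" "eventually (\<lambda>k. hat \<iota> (?r k) = k) ?F"
        by (auto simp: eventually_at_filter r intro!: always_eventually)
      have "((\<lambda>k. hat \<iota> (?r k)) \<longlongrightarrow> k) ?F"
        using tendsto_cong[OF ev(2), of k] by (simp add: tendsto_ident_at)
      then show "(?r \<longlongrightarrow> ?r k) ?F"
        using hat_tendsto_iff[OF ev(1), of "?r k"] k by (auto simp: r)
    qed
    ultimately have "homeomorphic_maps (top_of_set isometries) (top_of_set (hat \<iota> ` isometries)) (hat \<iota>) ?r"
      unfolding homeomorphic_maps_def by (auto simp: continuous_map_in_subtopology r)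
    then show ?thesis
      unfolding embedding_map_def using sub
      by (auto simp: homeomorphic_map_maps subtopology_subtopology Int_absorb1)
  qed
  show "left_complete (map_monoid (ellis \<iota>)) (top_of_set (ellis \<iota>))"
    unfolding left_complete_def
  proof (intro allI impI, elim conjE)
    interpret group "map_monoid (ellis \<iota>)" by (rule G)
    define J where "J f = inv\<^bsub>map_monoid (ellis \<iota>)\<^esub> f" for f
    have J: "f (J f x) = x" if "f \<in> ellis \<iota>" for f x
      using r_inv[of f] that by (simp add: J_def fun_eq_iff)
    fix F assume F: "F \<noteq> bot" "F \<times>\<^sub>F F \<le> left_uniformity (map_monoid (ellis \<iota>)) (top_of_set (ellis \<iota>))"
    have ev: "eventually (\<lambda>(f, g). f \<in> ellis \<iota> \<and> g \<in> ellis \<iota> \<and> J f \<circ> g \<in> U) (F \<times>\<^sub>F F)"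
      if "open U" "id \<in> U" for U
    proof -
      let ?U = "ellis \<iota> \<inter> U"
      have "left_uniformity (map_monoid (ellis \<iota>)) (top_of_set (ellis \<iota>))
          \<le> principal {(f, g). f \<in> ellis \<iota> \<and> g \<in> ellis \<iota> \<and> J f \<circ> g \<in> ?U}"
        unfolding left_uniformity_def J_def
        by (rule INF_lower2[of ?U]) (use that id_in_ellis in \<open>auto simp: openin_open_Int\<close>)
      with F(2) have "F \<times>\<^sub>F F \<le> principal {(f, g). f \<in> ellis \<iota> \<and> g \<in> ellis \<iota> \<and> J f \<circ> g \<in> ?U}"
        by (rule order_trans)
      then show ?thesis
        unfolding le_principal by (rule eventually_mono) auto
    qed
    have evE: "eventually (\<lambda>f. f \<in> ellis \<iota>) F"
      using ev[of UNIV] unfolding eventually_prod_same by (auto elim: eventually_mono)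
    have "cauchy_filter (filtermap (\<lambda>f. f y) F)" for y
      unfolding cauchy_filter_metric_filtermap
    proof (intro allI impI)
      fix e :: real assume "e > 0"
      \<comment> \<open>A neighbourhood of the identity that tests the single coordinate
        \<open>y\<close>; the one-element index set \<open>{()}\<close> encodes this one
        condition.\<close>
      have "open {f. f y \<in> ball y e}"
        using product_topology_basis'[of "{()}" "\<lambda>_. ball y e" "\<lambda>_. y"] by simp
      from ev[OF this] \<open>e > 0\<close> obtain P where P: "eventually P F"
          "\<And>f g. P f \<Longrightarrow> P g \<Longrightarrow> f \<in> ellis \<iota> \<and> J f (g y) \<in> ball y e"
        unfolding eventually_prod_same by auto
      \<comment> \<open>Applying \<open>f\<close> to \<open>y\<close> and \<open>J f (g y)\<close>
        gives \<open>f y\<close> and \<open>g y\<close> without changing the distance.\<close>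
      have "dist (f y) (g y) < e" if "P f" "P g" for f g
        using P(2)[OF that] dist_preservingD[OF ellis_dist_preserving, of f y "J f (g y)"] J[of f "g y"]
        by simp
      then show "\<exists>P. eventually P F \<and> (\<forall>f g. P f \<and> P g \<longrightarrow> dist (f y) (g y) < e)"
        using P(1) by blast
    qed
    moreover have "eventually (\<lambda>f. dist_preserving f) F"
      using evE by (rule eventually_mono) (rule ellis_dist_preserving)
    ultimately obtain l where l: "((\<lambda>f. f) \<longlongrightarrow> l) F"
      using dist_preserving_tendsto_exists[of F "\<lambda>f. f" UNIV] F(1) by auto
    then have "limitin (top_of_set (ellis \<iota>)) id l F"
      using ellis_tendsto[OF l F(1) evE] evE by (simp add: limitin_subtopology id_def)
    then show "\<exists>l. limitin (top_of_set (ellis \<iota>)) id l F" by blast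
  qed
qed

end

text \<open>A Cauchy sequence of the dense subgroup converges in the completion, hence so do the inverses.\<close>

lemma weil_completion_cauchy_inverse:
  fixes g :: "nat \<Rightarrow> 'a::metric_space \<Rightarrow> 'a"
  assumes W: "weil_completion (map_monoid (isometries :: ('a \<Rightarrow> 'a) set)) (top_of_set isometries) K S \<phi>"
    and g: "\<And>n. g n \<in> isometries" and c: "\<And>x. Cauchy (\<lambda>n. g n x)"
  shows "Cauchy (\<lambda>n. inv_into UNIV (g n) x)"
proof -
  note W' = W[unfolded weil_completion_def topological_group_def]
  interpret K: group K using W' by blast
  interpret I: group "map_monoid (isometries :: ('a \<Rightarrow> 'a) set)" by (rule group_isometries)
  have hom: "\<phi> \<in> hom (map_monoid isometries) K" using W' by blast
  interpret \<phi>: group_hom "map_monoid (isometries :: ('a \<Rightarrow> 'a) set)" K \<phi>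
    by (simp add: group_hom_def group_hom_axioms_def K.is_group I.is_group hom)
  have top: "topspace S = carrier K" using W' by blast
  obtain \<psi> where \<psi>: "homeomorphic_maps (top_of_set isometries) (subtopology S (\<phi> ` isometries)) \<phi> \<psi>"
    using W' by (auto simp: embedding_map_def homeomorphic_map_maps)
  have \<phi>_id: "\<phi> id = \<one>\<^bsub>K\<^esub>" using \<phi>.hom_one by simp
  have \<phi>_in: "\<phi> k \<in> carrier K" if "k \<in> isometries" for k using \<phi>.hom_closed[of k] that by simp
  have \<phi>_comp: "\<phi> (k \<circ> k') = \<phi> k \<otimes>\<^bsub>K\<^esub> \<phi> k'" if "k \<in> isometries" "k' \<in> isometries" for k k'
    using \<phi>.hom_mult[of k k'] that by simp
  define h where "h n = inv_into UNIV (g n)" for n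
  note h = isometries_inv[OF g, folded h_def]
  have inv_\<phi>: "inv\<^bsub>K\<^esub> (\<phi> (g n)) = \<phi> (h n)" for n
    using \<phi>.hom_inv[of "g n"] inv_map_monoid[OF group_isometries g h(1), of n] h(2) g
    by (simp add: fun_eq_iff)
  let ?F = "sequentially \<times>\<^sub>F sequentially"

  have "((\<lambda>p. h (fst p) \<circ> g (snd p)) \<longlongrightarrow> id) ?F"
    unfolding tendsto_fun_iff
  proof
    fix x
    \<comment> \<open>Pointwise Cauchyness of \<open>g\<close> is hereby the convergence of
      \<open>h n \<circ> g m\<close> to the identity along pairs of indices.\<close>
    have "dist (g n x) (g m x) = dist (h n (g m x)) x" for n m
      using isometries_dist[OF g, of n x "h n (g m x)"] by (simp add: h dist_commute)
    then have "((\<lambda>p. dist (h (fst p) (g (snd p) x)) x) \<longlongrightarrow> 0) ?F"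
      using c[of x, unfolded Cauchy_uniform cauchy_filter_filtermap_iff_tendsto] by (simp add: case_prod_unfold)
    then show "((\<lambda>p. (h (fst p) \<circ> g (snd p)) x) \<longlongrightarrow> id x) ?F"
      by (simp add: tendsto_dist_iff[symmetric])
  qed
  then have "limitin (top_of_set isometries) (\<lambda>p. h (fst p) \<circ> g (snd p)) id ?F"
    by (simp add: limitin_subtopology isometries_id isometries_comp h g)
  moreover have "continuous_map (top_of_set isometries) S \<phi>"
    using \<psi> by (simp add: homeomorphic_maps_def continuous_map_in_subtopology)
  ultimately have "limitin S (\<phi> \<circ> (\<lambda>p. h (fst p) \<circ> g (snd p))) (\<phi> id) ?F"
    by (rule continuous_map_limit[rotated])
  then have lim: "limitin S (\<lambda>p. inv\<^bsub>K\<^esub> (\<phi> (g (fst p))) \<otimes>\<^bsub>K\<^esub> \<phi> (g (snd p))) \<one>\<^bsub>K\<^esub> ?F"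
    by (simp add: o_def inv_\<phi> \<phi>_id \<phi>_comp[unfolded o_def] h g)
  let ?\<phi>g = "filtermap (\<lambda>n. \<phi> (g n)) sequentially"
  \<comment> \<open>The limit \<open>lim\<close> is the left Cauchy condition in \<open>K\<close>
    for the image filter, so left completeness supplies a limit \<open>l\<close>.\<close>
  have "?\<phi>g \<times>\<^sub>F ?\<phi>g \<le> left_uniformity K S"
    unfolding left_uniformity_def
  proof (rule INF_greatest)
    fix U assume "U \<in> {U. openin S U \<and> \<one>\<^bsub>K\<^esub> \<in> U}"
    then have "eventually (\<lambda>p. inv\<^bsub>K\<^esub> (\<phi> (g (fst p))) \<otimes>\<^bsub>K\<^esub> \<phi> (g (snd p)) \<in> U) ?F"
      using lim by (auto simp: limitin_def)
    then show "?\<phi>g \<times>\<^sub>F ?\<phi>g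
        \<le> principal {(x, y). x \<in> carrier K \<and> y \<in> carrier K \<and> inv\<^bsub>K\<^esub> x \<otimes>\<^bsub>K\<^esub> y \<in> U}"
      unfolding le_principal filtermap_prod_filter[symmetric] eventually_filtermap
      by (rule eventually_mono) (auto simp: \<phi>_in g)
  qed
  moreover have "?\<phi>g \<noteq> bot" by (simp add: filtermap_bot_iff)
  ultimately obtain l where "limitin S id l ?\<phi>g"
    using W' unfolding left_complete_def by blast
  then have l: "limitin S (\<lambda>n. \<phi> (g n)) l sequentially"
    by (simp add: limitin_def eventually_filtermap)
  then have lK: "l \<in> carrier K" using limitin_topspace top by metis
  have "continuous_map S S (\<lambda>x. inv\<^bsub>K\<^esub> x)" using W' by blast
  from continuous_map_limit[OF this l]
  have l': "limitin S (\<lambda>n. \<phi> (h n)) (inv\<^bsub>K\<^esub> l) sequentially" by (simp add: o_def inv_\<phi>)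
  have seq_fst: "limitin S (\<lambda>p. f (fst p)) a ?F" and seq_snd: "limitin S (\<lambda>p. f (snd p)) a ?F"
    if "limitin S f a sequentially" for f a
    using that eventually_compose_filterlim[OF _ filterlim_fst, of _ sequentially sequentially]
      eventually_compose_filterlim[OF _ filterlim_snd, of _ sequentially sequentially]
    unfolding limitin_def by blast+
  \<comment> \<open>The inverses now stand on the right, with an independent index:
    \<open>\<phi> (g n)\<close> tends to \<open>l\<close> and \<open>\<phi> (h m)\<close> to its
    inverse, so the products tend to the unit. Here the left Cauchy condition has become the right
    one.\<close>
  have "limitin (prod_topology S S) (\<lambda>p. (\<phi> (g (fst p)), \<phi> (h (snd p)))) (l, inv\<^bsub>K\<^esub> l) ?F"
    unfolding limitin_pairwise o_def using seq_fst[OF l] seq_snd[OF l'] by simp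
  moreover have "continuous_map (prod_topology S S) S (\<lambda>(x, y). x \<otimes>\<^bsub>K\<^esub> y)" using W' by blast
  ultimately have "limitin S ((\<lambda>(x, y). x \<otimes>\<^bsub>K\<^esub> y) \<circ> (\<lambda>p. (\<phi> (g (fst p)), \<phi> (h (snd p)))))
      ((\<lambda>(x, y). x \<otimes>\<^bsub>K\<^esub> y) (l, inv\<^bsub>K\<^esub> l)) ?F"
    by (rule continuous_map_limit[rotated])
  then have "limitin S (\<lambda>p. \<phi> (g (fst p) \<circ> h (snd p))) (\<phi> id) ?F"
    using lK by (simp add: o_def \<phi>_comp[unfolded o_def] g h(1) \<phi>_id)
  \<comment> \<open>The inverse \<open>\<psi>\<close> of the embedding is continuous on the image of
    \<phi>, so the limit is restricted to that subspace before being pulled back.\<close>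
  then have "limitin (subtopology S (\<phi> ` isometries)) (\<lambda>p. \<phi> (g (fst p) \<circ> h (snd p))) (\<phi> id) ?F"
    by (simp add: limitin_subtopology isometries_id isometries_comp g h(1))
  with \<psi> have "limitin (top_of_set isometries) (\<psi> \<circ> (\<lambda>p. \<phi> (g (fst p) \<circ> h (snd p)))) (\<psi> (\<phi> id)) ?F"
    by (intro continuous_map_limit) (auto simp: homeomorphic_maps_def)
  moreover have "\<psi> (\<phi> k) = k" if "k \<in> isometries" for k
    using \<psi> that by (simp add: homeomorphic_maps_def)
  ultimately have "limitin (top_of_set isometries) (\<lambda>p. g (fst p) \<circ> h (snd p)) id ?F"
    by (simp add: o_def isometries_id isometries_comp[unfolded o_def] g h(1))
  then have "((\<lambda>p. g (fst p) (h (snd p) x)) \<longlongrightarrow> x) ?F"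
    by (simp add: limitin_subtopology tendsto_fun_iff)
  then have "((\<lambda>p. dist (g (fst p) (h (snd p) x)) x) \<longlongrightarrow> 0) ?F"
    by (simp add: tendsto_dist_iff[symmetric])
  \<comment> \<open>Mirror image of the first computation: convergence of
    \<open>g n \<circ> h m\<close> to the identity is Cauchyness of the inverses.\<close>
  moreover have "dist (g n (h m x)) x = dist (h n x) (h m x)" for n m
    using isometries_dist[OF g, of n "h m x" "h n x"] by (simp add: h(3) dist_commute)
  ultimately show ?thesis
    unfolding Cauchy_uniform cauchy_filter_filtermap_iff_tendsto by (simp add: case_prod_unfold h_def)
qed


subsection \<open>Approximation of Ellis maps by isometries of the space\<close>

text \<open>The index \<open>N\<close> depends on \<open>y\<close> and \<open>e\<close> but not on
  \<open>f\<close>; this uniformity allows a whole net of Ellis maps to be replaced by isometries of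
  X at once. It holds because \<open>\<gamma> f n\<close> is chosen close to \<open>f\<close> at the
  first \<open>Suc n\<close> terms of one fixed dense sequence.\<close>

lemma ellis_uniform_approximation:
  fixes \<iota> :: "'a::metric_space \<Rightarrow> 'b::complete_space"
  assumes emb: "completion_embedding \<iota>" and sep: "separable_space (euclidean :: 'a topology)"
  obtains \<gamma> :: "('b \<Rightarrow> 'b) \<Rightarrow> nat \<Rightarrow> 'a \<Rightarrow> 'a"
  where "\<And>f n. f \<in> ellis \<iota> \<Longrightarrow> \<gamma> f n \<in> isometries"
    and "\<And>y e. e > 0 \<Longrightarrow> \<exists>N. \<forall>n\<ge>N. \<forall>f\<in>ellis \<iota>. dist (f y) (hat \<iota> (\<gamma> f n) y) < e"
proof -
  obtain C :: "'a set" where C: "countable C" "closure C = UNIV"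
    using sep by (auto simp: separable_space_def)
  define D where "D = from_nat_into C"
  have "C \<noteq> {}" using C(2) by auto
  then have D: "range D = C" unfolding D_def using C(1) by (rule range_from_nat_into)
  have "\<exists>g\<in>isometries. \<forall>k\<le>n. dist (f (\<iota> (D k))) (hat \<iota> g (\<iota> (D k))) < 1 / Suc n"
    if f: "f \<in> ellis \<iota>" for f n
  proof -
    \<comment> \<open>Only finitely many coordinates are restricted, so this is an open
      neighbourhood of \<open>f\<close> and meets the set of extensions.\<close>
    let ?U = "{h. \<forall>k\<in>{..n}. h (\<iota> (D k)) \<in> ball (f (\<iota> (D k))) (1 / Suc n)}"
    have "open ?U" by (rule product_topology_basis') auto
    moreover have "f \<in> ?U" by simp
    moreover have "f \<in> closure (hat \<iota> ` isometries)" using f ellis_eq_closure[OF emb] by blast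
    ultimately have "?U \<inter> hat \<iota> ` isometries \<noteq> {}"
      using open_Int_closure_eq_empty by blast
    then show ?thesis by auto
  qed
  then obtain \<gamma> where \<gamma>: "\<And>f n. f \<in> ellis \<iota> \<Longrightarrow> \<gamma> f n \<in> isometries"
      "\<And>f n k. f \<in> ellis \<iota> \<Longrightarrow> k \<le> n \<Longrightarrow> dist (f (\<iota> (D k))) (hat \<iota> (\<gamma> f n) (\<iota> (D k))) < 1 / Suc n"
    by metis
  have "\<exists>N. \<forall>n\<ge>N. \<forall>f\<in>ellis \<iota>. dist (f y) (hat \<iota> (\<gamma> f n) y) < e" if e: "e > 0" for y e
  proof -
    have e3: "e / 3 > 0" using e by simp
    \<comment> \<open>Two steps of size \<open>e / 6\<close> lead from \<open>y\<close> to a term of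
      the dense sequence. The approximation error there and the displacements under both maps then
      cost less than \<open>e / 3\<close> each.\<close>
    then obtain x where x: "dist (\<iota> x) y < e / 6"
      using embedding_dense[OF emb] e
      by (metis (no_types, lifting) UNIV_I closure_approachable rangeE divide_pos_pos zero_less_numeral)
    obtain k where k: "dist (D k) x < e / 6"
      using C(2) D e by (metis (no_types, lifting) UNIV_I closure_approachable rangeE divide_pos_pos zero_less_numeral)
    have Dy: "dist (\<iota> (D k)) y < e / 3"
      using x k dist_triangle[of "\<iota> (D k)" y "\<iota> x"] by (simp add: embedding_dist[OF emb])
    obtain N0 where N0: "1 / Suc N0 < e / 3" using e3 by (metis nat_approx_posE)
    have "dist (f y) (hat \<iota> (\<gamma> f n) y) < e" if n: "n \<ge> max k N0" and f: "f \<in> ellis \<iota>" for n f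
    proof -
      let ?d = "\<iota> (D k)"
      have "1 / Suc n \<le> 1 / Suc N0" using n by (simp add: frac_le)
      then have "dist (f ?d) (hat \<iota> (\<gamma> f n) ?d) < e / 3"
        using \<gamma>(2)[OF f, of k n] n N0 by simp
      moreover have "dist (f ?d) (f y) = dist ?d y"
        by (rule dist_preservingD[OF ellis_dist_preserving[OF emb f]])
      moreover have "dist (hat \<iota> (\<gamma> f n) ?d) (hat \<iota> (\<gamma> f n) y) = dist ?d y"
        by (rule dist_preservingD[OF hat_dist_preserving[OF emb \<gamma>(1)[OF f]]])
      ultimately show ?thesis
        using Dy dist_triangle[of "f y" "hat \<iota> (\<gamma> f n) y" "f ?d"]
          dist_triangle[of "f ?d" "hat \<iota> (\<gamma> f n) y" "hat \<iota> (\<gamma> f n) ?d"]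
        by (simp add: dist_commute)
    qed
    then show ?thesis by blast
  qed
  with \<gamma>(1) show thesis by (rule that)
qed

text \<open>Separability provides sequences instead of nets, the form in which
  \<open>divergent_limits\<close> is defined.\<close>

lemma ellis_sequence:
  fixes \<iota> :: "'a::metric_space \<Rightarrow> 'b::complete_space"
  assumes emb: "completion_embedding \<iota>" and sep: "separable_space (euclidean :: 'a topology)"
    and f: "f \<in> ellis \<iota>"
  obtains g :: "nat \<Rightarrow> 'a \<Rightarrow> 'a"
  where "\<And>n. g n \<in> isometries" "(\<lambda>n. hat \<iota> (g n)) \<longlonglongrightarrow> f"
proof -
  obtain \<gamma> :: "('b \<Rightarrow> 'b) \<Rightarrow> nat \<Rightarrow> 'a \<Rightarrow> 'a"
    where \<gamma>: "\<And>f n. f \<in> ellis \<iota> \<Longrightarrow> \<gamma> f n \<in> isometries"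
      "\<And>y e. e > 0 \<Longrightarrow> \<exists>N. \<forall>n\<ge>N. \<forall>f\<in>ellis \<iota>. dist (f y) (hat \<iota> (\<gamma> f n) y) < e"
    using ellis_uniform_approximation[OF emb sep] by blast
  have "(\<lambda>n. hat \<iota> (\<gamma> f n)) \<longlonglongrightarrow> f"
    unfolding tendsto_fun_iff lim_sequentially using \<gamma>(2) f by (metis dist_commute)
  with \<gamma>(1)[OF f] show thesis by (rule that)
qed

text \<open>Isometries \<open>g n\<close> whose extensions tend to \<open>f\<close> are pointwise
  Cauchy; by \<open>weil_completion_cauchy_inverse\<close> so are their inverses, whose extensions
  then converge to some \<open>k\<close>. The compositions are constantly \<open>id\<close>, and
  joint continuity makes \<open>k\<close> a two-sided inverse of \<open>f\<close>.\<close>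

lemma ellis_group_if_weil_completion:
  fixes \<iota> :: "'a::metric_space \<Rightarrow> 'b::complete_space"
  assumes emb: "completion_embedding \<iota>" and sep: "separable_space (euclidean :: 'a topology)"
    and W: "weil_completion (map_monoid (isometries :: ('a \<Rightarrow> 'a) set)) (top_of_set isometries) K S \<phi>"
  shows "group (map_monoid (ellis \<iota>))"
  unfolding group_ellis_iff[OF emb]
proof
  fix f assume f: "f \<in> ellis \<iota>"
  obtain g :: "nat \<Rightarrow> 'a \<Rightarrow> 'a" where g: "\<And>n. g n \<in> isometries" and lim: "(\<lambda>n. hat \<iota> (g n)) \<longlonglongrightarrow> f"
    using ellis_sequence[OF emb sep f] by blast
  define h where "h n = inv_into UNIV (g n)" for n
  note h = isometries_inv[OF g, folded h_def]
  have "Cauchy (\<lambda>n. g n x)" for x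
  proof -
    have "cauchy_filter (filtermap (\<lambda>n. hat \<iota> (g n) (\<iota> x)) sequentially)"
      using lim by (intro tendsto_imp_cauchy_filter[of _ "f (\<iota> x)"]) (simp add: tendsto_fun_iff)
    then show ?thesis
      by (simp add: hat_apply(1)[OF emb g] embedding_cauchy[OF emb] Cauchy_uniform)
  qed
  then have "Cauchy (\<lambda>n. h n x)" for x
    unfolding h_def by (rule weil_completion_cauchy_inverse[OF W g])
  then have "cauchy_filter (filtermap (\<lambda>n. hat \<iota> (h n) (\<iota> x)) sequentially)" for x
    by (simp add: hat_apply(1)[OF emb h(1)] embedding_cauchy[OF emb] Cauchy_uniform)
  then have "cauchy_filter (filtermap (\<lambda>n. hat \<iota> (h n) y) sequentially)" if "y \<in> range \<iota>" for y
    using that by blast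
  then obtain k where k: "(\<lambda>n. hat \<iota> (h n)) \<longlonglongrightarrow> k"
    using dist_preserving_tendsto_exists[of sequentially "\<lambda>n. hat \<iota> (h n)" "range \<iota>"]
      embedding_dense[OF emb] hat_dist_preserving[OF emb h(1)] by auto
  have "k \<in> ellis \<iota>"
    using ellis_tendsto[OF emb k] hat_in_ellis[OF emb h(1)] by simp
  moreover have "hat \<iota> (h n) \<circ> hat \<iota> (g n) = id" "hat \<iota> (g n) \<circ> hat \<iota> (h n) = id" for n
    unfolding h_def by (rule hat_inverse[OF emb g])+
  then have "k \<circ> f = id" "f \<circ> k = id"
    using dist_preserving_tendsto_comp[OF k _ lim] dist_preserving_tendsto_comp[OF lim _ k]
      hat_dist_preserving[OF emb g] hat_dist_preserving[OF emb h(1)]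
    by (auto simp: tendsto_fun_iff fun_eq_iff LIMSEQ_const_iff)
  ultimately show "\<exists>h\<in>ellis \<iota>. h \<circ> f = id \<and> f \<circ> h = id" by blast
qed


section \<open>Properness\<close>

text \<open>Cauchy-indivisibility enters here. It concerns isometries of X, so the maps
  \<open>f i\<close> are first approximated by such isometries, and the conclusion is then carried
  back.\<close>

lemma ellis_subnet_tendsto:
  fixes \<iota> :: "'a::metric_space \<Rightarrow> 'b::complete_space" and f :: "'i \<Rightarrow> 'b \<Rightarrow> 'b"
  assumes emb: "completion_embedding \<iota>" and sep: "separable_space (euclidean :: 'a topology)"
    and ci: "cauchy_indivisible (isometries :: ('a \<Rightarrow> 'a) set)"
    and F: "F \<noteq> bot" "eventually (\<lambda>i. f i \<in> ellis \<iota>) F"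
    and z: "((\<lambda>i. f i (\<iota> x)) \<longlongrightarrow> z) F"
  obtains F' l where "F' \<le> F" "F' \<noteq> bot" "l \<in> ellis \<iota>" "(f \<longlongrightarrow> l) F'"
proof -
  obtain \<gamma> :: "('b \<Rightarrow> 'b) \<Rightarrow> nat \<Rightarrow> 'a \<Rightarrow> 'a"
    where \<gamma>: "\<And>f n. f \<in> ellis \<iota> \<Longrightarrow> \<gamma> f n \<in> isometries"
      "\<And>y e. e > 0 \<Longrightarrow> \<exists>N. \<forall>n\<ge>N. \<forall>f\<in>ellis \<iota>. dist (f y) (hat \<iota> (\<gamma> f n) y) < e"
    using ellis_uniform_approximation[OF emb sep] by blast
  \<comment> \<open>The accuracy of the approximation becomes a second index. Along
    \<open>F2\<close> the isometry \<open>G p\<close> and the map \<open>f (fst p)\<close> get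
    arbitrarily close at every point of X.\<close>
  define F2 where "F2 = F \<times>\<^sub>F (sequentially :: nat filter)"
  define G where "G p = \<gamma> (f (fst p)) (snd p)" for p
  have F2: "F2 \<noteq> bot" using F(1) by (simp add: F2_def prod_filter_eq_bot)
  have evE: "eventually (\<lambda>p. f (fst p) \<in> ellis \<iota>) F2"
    unfolding F2_def using F(2) by (rule eventually_compose_filterlim[OF _ filterlim_fst])
  have evG: "eventually (\<lambda>p. G p \<in> isometries) F2"
    using evE by eventually_elim (simp add: G_def \<gamma>(1))
  have close: "((\<lambda>p. dist (\<iota> (G p y)) (f (fst p) (\<iota> y))) \<longlongrightarrow> 0) F2" for y
  proof (rule tendstoI)
    fix e :: real assume "e > 0"
    then obtain N where N: "\<And>n f. n \<ge> N \<Longrightarrow> f \<in> ellis \<iota> \<Longrightarrow> dist (f (\<iota> y)) (hat \<iota> (\<gamma> f n) (\<iota> y)) < e"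
      using \<gamma>(2) by blast
    have "eventually (\<lambda>p. f (fst p) \<in> ellis \<iota> \<and> snd p \<ge> N) F2"
      unfolding F2_def by (rule eventually_prodI[OF F(2) eventually_ge_at_top])
    then show "eventually (\<lambda>p. dist (dist (\<iota> (G p y)) (f (fst p) (\<iota> y))) 0 < e) F2"
      by eventually_elim (use N hat_apply(1)[OF emb \<gamma>(1)] in \<open>simp add: G_def dist_commute\<close>)
  qed
  have transfer: "cauchy_filter (filtermap (\<lambda>p. f (fst p) (\<iota> y)) F3)"
    if "cauchy_filter (filtermap (\<lambda>p. G p y) F3)" "F3 \<le> F2" for y F3
  proof (rule cauchy_filter_close)
    show "cauchy_filter (filtermap (\<lambda>p. \<iota> (G p y)) F3)" using that(1) by (simp add: embedding_cauchy[OF emb])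
  qed (rule tendsto_mono[OF that(2) close])
  \<comment> \<open>Either \<open>G\<close> diverges, and indivisibility spreads Cauchyness from
    \<open>x\<close> to all points, or a subnet of \<open>G\<close> converges to an isometry and is
    Cauchy at every point for that reason.\<close>
  have "\<exists>F3\<le>F2. F3 \<noteq> bot \<and> (\<forall>y. cauchy_filter (filtermap (\<lambda>p. G p y) F3))"
  proof (cases "to_infinity (top_of_set isometries) G F2")
    case True
    have lim: "((\<lambda>p. f (fst p) (\<iota> x)) \<longlongrightarrow> z) F2"
      unfolding F2_def by (rule filterlim_compose[OF z filterlim_fst])
    have eq: "(\<lambda>p. dist (f (fst p) (\<iota> x)) (\<iota> (G p x))) = (\<lambda>p. dist (\<iota> (G p x)) (f (fst p) (\<iota> x)))"
      by (rule ext) (rule dist_commute)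
    have "cauchy_filter (filtermap (\<lambda>p. \<iota> (G p x)) F2)"
      by (rule cauchy_filter_close[OF tendsto_imp_cauchy_filter[OF lim]], unfold eq, rule close)
    then have "cauchy_filter (filtermap (\<lambda>p. G p x) F2)" by (simp add: embedding_cauchy[OF emb])
    from cauchy_indivisible_family[OF ci F2 evG True this] F2 show ?thesis by blast
  next
    case False
    then obtain F3 l where "F3 \<le> F2" "F3 \<noteq> bot" "(G \<longlongrightarrow> l) F3"
      by (auto simp: to_infinity_def limitin_subtopology)
    then show ?thesis using tendsto_imp_cauchy_filter unfolding tendsto_fun_iff by blast
  qed
  then obtain F3 where F3: "F3 \<le> F2" "F3 \<noteq> bot" "\<And>y. cauchy_filter (filtermap (\<lambda>p. f (fst p) (\<iota> y)) F3)"
    using transfer by blast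
  have evE3: "eventually (\<lambda>p. f (fst p) \<in> ellis \<iota>) F3" using evE F3(1) by (rule filter_leD[rotated])
  then have "eventually (\<lambda>p. dist_preserving (f (fst p))) F3"
    by (rule eventually_mono) (rule ellis_dist_preserving[OF emb])
  then obtain l where l: "((\<lambda>p. f (fst p)) \<longlongrightarrow> l) F3"
    using dist_preserving_tendsto_exists[of F3 "\<lambda>p. f (fst p)" "range \<iota>"] F3 embedding_dense[OF emb]
    by auto
  show thesis
  \<comment> \<open>Forgetting the accuracy index yields a filter finer than
    \<open>F\<close>.\<close>
  proof (rule that[of "filtermap fst F3"])
    show "filtermap fst F3 \<le> F"
      using F3(1) filtermap_fst_prod_filter unfolding F2_def by (metis filtermap_mono order_trans)
    show "filtermap fst F3 \<noteq> bot" using F3(2) by (simp add: filtermap_bot_iff)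
    show "l \<in> ellis \<iota>" by (rule ellis_tendsto[OF emb l F3(2) evE3])
    show "(f \<longlongrightarrow> l) (filtermap fst F3)" using l by (simp add: filterlim_filtermap)
  qed
qed

text \<open>A limit point \<^term>\<open>h (\<iota> x)\<close> is reduced to \<^term>\<open>\<iota> x\<close> by passing from \<^term>\<open>f i\<close> to
  \<^term>\<open>f i \<circ> h\<close>; this is undone by \<open>h\<inverse>\<close>.\<close>

lemma ellis_subnet_tendsto_limit_points:
  fixes \<iota> :: "'a::metric_space \<Rightarrow> 'b::complete_space" and f :: "'i \<Rightarrow> 'b \<Rightarrow> 'b"
  assumes emb: "completion_embedding \<iota>" and sep: "separable_space (euclidean :: 'a topology)"
    and ci: "cauchy_indivisible (isometries :: ('a \<Rightarrow> 'a) set)"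
    and G: "group (map_monoid (ellis \<iota>))"
    and F: "F \<noteq> bot" "eventually (\<lambda>i. f i \<in> ellis \<iota>) F"
    and y: "y \<in> range \<iota> \<union> limit_points \<iota>" and z: "((\<lambda>i. f i y) \<longlongrightarrow> z) F"
  obtains F' l where "F' \<le> F" "F' \<noteq> bot" "l \<in> ellis \<iota>" "(f \<longlongrightarrow> l) F'"
proof -
  \<comment> \<open>For a point of the image of X, \<open>h\<close> is the identity.\<close>
  obtain h x where h: "h \<in> ellis \<iota>" "y = h (\<iota> x)"
    using y id_in_ellis[OF emb] divergent_limits_subset_ellis[OF emb]
    unfolding limit_points_def by (auto dest: subsetD)
  obtain k where k: "k \<in> ellis \<iota>" "h \<circ> k = id"
    using G h(1) unfolding group_ellis_iff[OF emb] by blast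
  have "eventually (\<lambda>i. f i \<circ> h \<in> ellis \<iota>) F"
    using F(2) by eventually_elim (rule ellis_comp[OF emb _ h(1)])
  moreover have "((\<lambda>i. (f i \<circ> h) (\<iota> x)) \<longlongrightarrow> z) F" using z h(2) by simp
  ultimately obtain F' l where l: "F' \<le> F" "F' \<noteq> bot" "l \<in> ellis \<iota>" "((\<lambda>i. f i \<circ> h) \<longlongrightarrow> l) F'"
    using ellis_subnet_tendsto[OF emb sep ci F(1), of "\<lambda>i. f i \<circ> h" x z] by blast
  have "((\<lambda>i. f i (h (k y))) \<longlongrightarrow> l (k y)) F'" for y
    using l(4) by (simp add: tendsto_fun_iff)
  moreover have "h (k y) = y" for y using k(2) by (metis comp_apply id_apply)
  ultimately have "(f \<longlongrightarrow> l \<circ> k) F'" by (simp add: tendsto_fun_iff)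
  with l(1,2) ellis_comp[OF emb l(3) k(1)] show thesis by (rule that)
qed

text \<open>Closedness of \<omega> and compactness of its fibres both follow from one clustering
  property, \<open>cluster\<close>: a filter whose image under \<omega> converges to a point over
  \<open>Y\<close> has a refinement converging to a preimage of that point.\<close>

lemma proper_if_ellis_group:
  fixes \<iota> :: "'a::metric_space \<Rightarrow> 'b::complete_space"
  assumes emb: "completion_embedding \<iota>" and sep: "separable_space (euclidean :: 'a topology)"
    and ci: "cauchy_indivisible (isometries :: ('a \<Rightarrow> 'a) set)"
    and G: "group (map_monoid (ellis \<iota>))"
  defines "Y \<equiv> range \<iota> \<union> limit_points \<iota>"
  shows "continuous_proper_map (top_of_set (ellis \<iota> \<times> Y)) (top_of_set (Y \<times> UNIV)) (\<lambda>(f, y). (y, f y))"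
proof -
  let ?\<omega> = "\<lambda>(f :: 'b \<Rightarrow> 'b, y :: 'b). (y, f y)"
  note subnet = ellis_subnet_tendsto_limit_points[OF emb sep ci G, folded Y_def]
  have cont: "continuous_on (ellis \<iota> \<times> Y) ?\<omega>"
    unfolding continuous_on_def
  proof
    fix p assume "p \<in> ellis \<iota> \<times> Y"
    let ?F = "at p within ellis \<iota> \<times> Y"
    have lims: "(fst \<longlongrightarrow> fst p) ?F" "(snd \<longlongrightarrow> snd p) ?F"
      by (rule tendsto_fst[OF tendsto_ident_at] tendsto_snd[OF tendsto_ident_at])+
    have "eventually (\<lambda>p. dist_preserving (fst p)) ?F"
      by (auto simp: eventually_at_filter ellis_dist_preserving[OF emb] intro!: always_eventually)
    from tendsto_Pair[OF lims(2) dist_preserving_tendsto[OF lims(1) this lims(2)]]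
    show "(?\<omega> \<longlongrightarrow> ?\<omega> p) ?F" by (simp add: case_prod_unfold)
  qed
  have cluster: "\<exists>F'\<le>F. \<exists>l\<in>ellis \<iota>. F' \<noteq> bot \<and> l y = z \<and> ((\<lambda>p. p) \<longlongrightarrow> (l, y)) F'"
    if F: "F \<noteq> bot" "eventually (\<lambda>p. p \<in> ellis \<iota> \<times> Y) F" and y: "y \<in> Y" and lim: "(?\<omega> \<longlongrightarrow> (y, z)) F"
    for F y z
  proof -
    have lim1: "(snd \<longlongrightarrow> y) F" and lim2: "((\<lambda>p. fst p (snd p)) \<longlongrightarrow> z) F"
      using tendsto_fst[OF lim] tendsto_snd[OF lim] by (simp_all add: case_prod_unfold)
    have evE: "eventually (\<lambda>p. fst p \<in> ellis \<iota>) F"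
      using F(2) by eventually_elim auto
    \<comment> \<open>The moving point \<open>snd p\<close> is replaced by its limit
      \<open>y\<close>; distance preservation makes the change in value equal to
      \<open>dist (snd p) y\<close>.\<close>
    have "((\<lambda>p. dist (snd p) y) \<longlongrightarrow> 0) F"
      using lim1 by (simp add: tendsto_dist_iff[symmetric])
    moreover have "eventually (\<lambda>p. dist (snd p) y = dist (fst p (snd p)) (fst p y)) F"
      using evE by eventually_elim (simp add: dist_preservingD[OF ellis_dist_preserving[OF emb]])
    ultimately have "((\<lambda>p. dist (fst p (snd p)) (fst p y)) \<longlongrightarrow> 0) F"
      by (rule Lim_transform_eventually)
    then have "((\<lambda>p. fst p y) \<longlongrightarrow> z) F" by (rule tendsto_close[OF lim2])
    then obtain F' l where l: "F' \<le> F" "F' \<noteq> bot" "l \<in> ellis \<iota>" "(fst \<longlongrightarrow> l) F'"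
      using subnet[OF F(1) evE y] by blast
    have "((\<lambda>p. (fst p, snd p)) \<longlongrightarrow> (l, y)) F'"
      by (rule tendsto_Pair[OF l(4) tendsto_mono[OF l(1) lim1]])
    moreover have "((\<lambda>p. fst p y) \<longlongrightarrow> l y) F'" using l(4) by (simp add: tendsto_fun_iff)
    then have "l y = z"
      using \<open>((\<lambda>p. fst p y) \<longlongrightarrow> z) F\<close> l(1,2) by (metis tendsto_mono tendsto_unique)
    ultimately show ?thesis using l by auto
  qed
  have "closed_map (top_of_set (ellis \<iota> \<times> Y)) (top_of_set (Y \<times> UNIV)) ?\<omega>"
    unfolding closed_map_def
  proof (intro allI impI)
    fix C assume "closedin (top_of_set (ellis \<iota> \<times> Y)) C"
    then obtain C' where C': "closed C'" "C = ellis \<iota> \<times> Y \<inter> C'" by (auto simp: closedin_closed)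
    have "(y, z) \<in> ?\<omega> ` C" if y: "y \<in> Y" and yz: "(y, z) \<in> closure (?\<omega> ` C)" for y z
    proof -
      \<comment> \<open>The points of \<open>C\<close> whose images approach \<open>(y, z)\<close>;
        the filter is proper because \<open>(y, z)\<close> lies in the closure of the image of
        \<open>C\<close>.\<close>
      let ?F = "inf (filtercomap ?\<omega> (nhds (y, z))) (principal C)"
      have "?F \<noteq> bot"
      proof
        assume "?F = bot"
        then have "eventually (\<lambda>_. False) ?F" by simp
        then obtain Q where "eventually Q (nhds (y, z))" "\<And>p. Q (?\<omega> p) \<Longrightarrow> p \<notin> C"
          unfolding eventually_inf_principal eventually_filtercomap by blast
        then obtain U where "open U" "(y, z) \<in> U" "U \<inter> ?\<omega> ` C = {}"
          unfolding eventually_nhds by blast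
        then show False using yz open_Int_closure_eq_empty by blast
      qed
      moreover have evC: "eventually (\<lambda>p. p \<in> C) ?F" by (simp add: eventually_inf_principal)
      then have "eventually (\<lambda>p. p \<in> ellis \<iota> \<times> Y) ?F"
        by (rule eventually_mono) (use C'(2) in blast)
      moreover have "(?\<omega> \<longlongrightarrow> (y, z)) ?F"
        by (rule tendsto_mono[OF inf_le1]) (rule filterlim_filtercomap)
      ultimately obtain F' l where l: "F' \<le> ?F" "l \<in> ellis \<iota>" "F' \<noteq> bot" "l y = z" "((\<lambda>p. p) \<longlongrightarrow> (l, y)) F'"
        using cluster[OF _ _ y] by blast
      have "eventually (\<lambda>p. p \<in> C') F'"
        using filter_leD[OF l(1) evC] by (rule eventually_mono) (use C'(2) in blast)
      then have "(l, y) \<in> C'" using Lim_in_closed_set[OF C'(1) _ l(3,5)] by blast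
      then have "(l, y) \<in> C" using C'(2) l(2) y by blast
      then show ?thesis using l(4) by force
    qed
    then have "?\<omega> ` C = (Y \<times> UNIV) \<inter> closure (?\<omega> ` C)"
      using closure_subset[of "?\<omega> ` C"] C'(2) by auto
    then show "closedin (top_of_set (Y \<times> UNIV)) (?\<omega> ` C)"
      by (metis closedin_closed_Int closed_closure)
  qed
  moreover have "compact {p \<in> ellis \<iota> \<times> Y. ?\<omega> p = (y, z)}" if y: "y \<in> Y" for y z
    unfolding compact_filter
  proof (intro allI impI)
    fix F assume F: "F \<noteq> bot" "eventually (\<lambda>p. p \<in> {p \<in> ellis \<iota> \<times> Y. ?\<omega> p = (y, z)}) F"
    have "eventually (\<lambda>p. p \<in> ellis \<iota> \<times> Y) F" "eventually (\<lambda>p. ?\<omega> p = (y, z)) F"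
      using F(2) by (auto elim: eventually_mono)
    then obtain F' l where l: "F' \<le> F" "l \<in> ellis \<iota>" "F' \<noteq> bot" "l y = z" "((\<lambda>p. p) \<longlongrightarrow> (l, y)) F'"
      using cluster[OF F(1) _ y, of z] tendsto_eventually by blast
    \<comment> \<open>Lying below both filters, the proper filter \<open>F'\<close> shows that
      \<open>(l, y)\<close> is a cluster point of \<open>F\<close>.\<close>
    have "F' \<le> inf (nhds (l, y)) F" using l(1,5) by (simp add: filterlim_def filtermap_ident)
    then have "inf (nhds (l, y)) F \<noteq> bot" using l(3) by (metis bot.extremum_uniqueI)
    then show "\<exists>p\<in>{p \<in> ellis \<iota> \<times> Y. ?\<omega> p = (y, z)}. inf (nhds p) F \<noteq> bot"
      using l(2,4) y by (intro bexI[of _ "(l, y)"]) auto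
  qed
  ultimately show ?thesis
    unfolding continuous_proper_map_def proper_map_def
    using cont by (auto simp: continuous_map_in_subtopology compactin_subtopology)
qed

text \<open>Since \<open>Y\<close> contains the limit points, \<open>f (\<iota> x)\<close> is an
  admissible base point when the approximating isometries diverge. Their inverses converge there,
  and properness turns this into a cluster point in E.\<close>

lemma ellis_group_if_proper:
  fixes \<iota> :: "'a::metric_space \<Rightarrow> 'b::complete_space"
  assumes emb: "completion_embedding \<iota>" and sep: "separable_space (euclidean :: 'a topology)"
  defines "Y \<equiv> range \<iota> \<union> limit_points \<iota>"
  assumes proper: "proper_map (top_of_set (ellis \<iota> \<times> Y)) (top_of_set (Y \<times> UNIV)) (\<lambda>(f, y). (y, f y))"
  shows "group (map_monoid (ellis \<iota>))"
  unfolding group_ellis_iff[OF emb]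
proof
  fix f assume f: "f \<in> ellis \<iota>"
  obtain g :: "nat \<Rightarrow> 'a \<Rightarrow> 'a" where g: "\<And>n. g n \<in> isometries" and lim: "(\<lambda>n. hat \<iota> (g n)) \<longlonglongrightarrow> f"
    using ellis_sequence[OF emb sep f] by blast
  define h where "h n = hat \<iota> (inv_into UNIV (g n))" for n
  note inv = isometries_inv[OF g]
  have hE: "h n \<in> ellis \<iota>" for n unfolding h_def by (rule hat_in_ellis[OF emb inv(1)])
  have hg: "h n \<circ> hat \<iota> (g n) = id" "hat \<iota> (g n) \<circ> h n = id" for n
    unfolding h_def by (rule hat_inverse[OF emb g])+
  show "\<exists>h\<in>ellis \<iota>. h \<circ> f = id \<and> f \<circ> h = id"
  proof (cases "to_infinity (top_of_set isometries) g sequentially")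
    case True
    fix x :: 'a
    define y where "y = f (\<iota> x)"
    have "f \<in> divergent_limits \<iota>"
      unfolding divergent_limits_def
      using True g lim ellis_dist_preserving[OF emb f] hat_apply(2)[OF emb g]
      by (auto simp: limitin_subtopology dist_preserving_continuous intro!: exI[of _ g])
    then have y: "y \<in> Y" unfolding Y_def limit_points_def y_def by blast
    \<comment> \<open>As \<open>hat \<iota> (g n)\<close> moves \<open>\<iota> x\<close> towards
      \<open>y\<close>, its inverse moves \<open>y\<close> back towards \<open>\<iota> x\<close> at
      the same rate.\<close>
    have "dist (h n y) (\<iota> x) = dist (hat \<iota> (g n) (\<iota> x)) y" for n
      using dist_preservingD[OF hat_dist_preserving[OF emb g], of n "h n y" "\<iota> x"] hg(2)[of n]
      by (simp add: fun_eq_iff dist_commute)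
    moreover have "(\<lambda>n. dist (hat \<iota> (g n) (\<iota> x)) y) \<longlonglongrightarrow> 0"
      using lim unfolding y_def by (simp add: tendsto_fun_iff tendsto_dist_iff[symmetric])
    ultimately have "(\<lambda>n. h n y) \<longlonglongrightarrow> \<iota> x" by (subst tendsto_dist_iff) simp
    then have "limitin (top_of_set (Y \<times> UNIV)) (\<lambda>n. (y, h n y)) (y, \<iota> x) sequentially"
      using y by (simp add: limitin_subtopology tendsto_Pair)
    \<comment> \<open>A convergent sequence together with its limit is compact. Its preimage under
      the proper map is compact and contains every \<open>(h n, y)\<close>, so these pairs
      cluster.\<close>
    then have "compactin (top_of_set (Y \<times> UNIV)) (insert (y, \<iota> x) (range (\<lambda>n. (y, h n y))))"
      using y by (intro compactin_sequence_with_limit) auto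
    from compactin_proper_map_preimage[OF proper this]
    have "compact {p \<in> ellis \<iota> \<times> Y. (\<lambda>(f, y). (y, f y)) p \<in> insert (y, \<iota> x) (range (\<lambda>n. (y, h n y)))}"
      (is "compact ?K") by (simp add: compactin_subtopology)
    moreover have "eventually (\<lambda>p. p \<in> ?K) (filtermap (\<lambda>n. (h n, y)) sequentially)"
      using hE y by (simp add: eventually_filtermap)
    moreover have "filtermap (\<lambda>n. (h n, y)) sequentially \<noteq> bot" by (simp add: filtermap_bot_iff)
    ultimately obtain p where p: "p \<in> ?K" "inf (nhds p) (filtermap (\<lambda>n. (h n, y)) sequentially) \<noteq> bot"
      unfolding compact_filter by blast
    define k where "k = fst p"
    have k: "k \<in> ellis \<iota>" using p(1) unfolding k_def by auto
    \<comment> \<open>Pulls the cluster point back to a filter on the indices finer than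
      \<open>sequentially\<close>: along it \<open>h\<close> tends to \<open>k\<close>, and the
      convergence of the extensions to \<open>f\<close> is retained.\<close>
    define F where "F = inf sequentially (filtercomap (\<lambda>n. (h n, y)) (nhds p))"
    have "F \<noteq> bot"
    proof
      assume "F = bot"
      then have "eventually (\<lambda>_. False) F" by simp
      then obtain P Q where PQ: "eventually P sequentially" "eventually Q (nhds p)" "\<And>n. P n \<Longrightarrow> \<not> Q (h n, y)"
        unfolding F_def eventually_inf eventually_filtercomap by metis
      have "eventually (\<lambda>q. \<not> Q q) (filtermap (\<lambda>n. (h n, y)) sequentially)"
        unfolding eventually_filtermap using PQ(1) by (rule eventually_mono) (rule PQ(3))
      with PQ(2) have "eventually (\<lambda>_. False) (inf (nhds p) (filtermap (\<lambda>n. (h n, y)) sequentially))"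
        unfolding eventually_inf by blast
      then show False using p(2) by (simp add: eventually_False)
    qed
    have "((\<lambda>n. (h n, y)) \<longlongrightarrow> p) F"
      unfolding F_def by (rule tendsto_mono[OF inf_le2]) (rule filterlim_filtercomap)
    from tendsto_fst[OF this] have hk: "(h \<longlongrightarrow> k) F" by (simp add: k_def)
    have gf: "((\<lambda>n. hat \<iota> (g n)) \<longlongrightarrow> f) F"
      unfolding F_def by (rule tendsto_mono[OF inf_le1 lim])
    have "k \<circ> f = id" "f \<circ> k = id"
      using dist_preserving_tendsto_comp[OF hk _ gf] dist_preserving_tendsto_comp[OF gf _ hk]
        hat_dist_preserving[OF emb g] ellis_dist_preserving[OF emb hE] hg \<open>F \<noteq> bot\<close>
      by (auto simp: tendsto_fun_iff fun_eq_iff tendsto_const_iff)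
    with k show ?thesis by blast
  next
    case False
    \<comment> \<open>Without divergence a subnet converges to an isometry \<open>l\<close> of X; by
      uniqueness of limits \<open>f\<close> is the extension of \<open>l\<close>, and the inverse of
      \<open>l\<close> extends to the inverse of \<open>f\<close>.\<close>
    then obtain F l where F: "F \<le> sequentially" "F \<noteq> bot" "l \<in> isometries" "(g \<longlongrightarrow> l) F"
      by (auto simp: to_infinity_def limitin_subtopology)
    have "((\<lambda>n. hat \<iota> (g n)) \<longlongrightarrow> hat \<iota> l) F"
      using hat_tendsto_iff[OF emb _ F(3), of g F] F(4) g by simp
    moreover have "((\<lambda>n. hat \<iota> (g n)) \<longlongrightarrow> f) F" by (rule tendsto_mono[OF F(1) lim])
    ultimately have "f = hat \<iota> l"
      using F(2) unfolding tendsto_fun_iff by (metis ext tendsto_unique)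
    then show ?thesis
      using hat_in_ellis[OF emb isometries_inv(1)[OF F(3)]] hat_inverse[OF emb F(3)] by blast
  qed
qed

theorem proposition5p16:
  fixes \<iota> :: "'a::metric_space \<Rightarrow> 'b::complete_space"
  assumes "separable_space (euclidean :: 'a topology)"
    and "completion_embedding \<iota>"
    and "cauchy_indivisible (isometries :: ('a \<Rightarrow> 'a) set)"
  shows
    "(continuous_proper_map
        (prod_topology (top_of_set (ellis \<iota>)) (top_of_set (range \<iota> \<union> limit_points \<iota>)))
        (prod_topology (top_of_set (range \<iota> \<union> limit_points \<iota>)) euclidean)
        (\<lambda>(f, y). (y, f y))
      \<longleftrightarrow> group (map_monoid (ellis \<iota>)))
   \<and> (group (map_monoid (ellis \<iota>))
      \<longleftrightarrow> has_weil_completion (map_monoid (isometries :: ('a \<Rightarrow> 'a) set)) (top_of_set isometries))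
   \<and> (group (map_monoid (ellis \<iota>))
      \<longrightarrow> subgroup (ellis \<iota>) (map_monoid isometries)
        \<and> closedin (top_of_set isometries) (ellis \<iota>))
   \<and> (has_weil_completion (map_monoid (isometries :: ('a \<Rightarrow> 'a) set)) (top_of_set isometries)
      \<longrightarrow> weil_completion (map_monoid isometries) (top_of_set isometries)
            (map_monoid (ellis \<iota>)) (top_of_set (ellis \<iota>)) (hat \<iota>))"
proof -
  note sep = assms(1) and emb = assms(2) and ci = assms(3)
  have euc: "prod_topology (top_of_set Y) (euclidean :: 'b topology) = top_of_set (Y \<times> UNIV)" for Y :: "'b set"
    using prod_topology_subtopology_eu[of Y "UNIV :: 'b set"] by simp
  \<comment> \<open>The implication holds for a completion on any carrier type, so the witness in
    \<open>has_weil_completion\<close> may be used as it is. Conversely,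
    \<open>has_weil_completionI\<close> moves the Ellis group to the carrier type fixed
    there.\<close>
  have "group (map_monoid (ellis \<iota>))"
    if "has_weil_completion (map_monoid (isometries :: ('a \<Rightarrow> 'a) set)) (top_of_set isometries)"
    using that ellis_group_if_weil_completion[OF emb sep] unfolding has_weil_completion_def by blast
  then show ?thesis
    using proper_if_ellis_group[OF emb sep ci] ellis_group_if_proper[OF emb sep]
      weil_completion_ellis[OF emb] has_weil_completionI ellis_subgroup[OF emb]
    unfolding euc prod_topology_subtopology_eu continuous_proper_map_def by blast
qed

end
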